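(* Let $(W,S)$ be a Coxeter system with $S$ finite. Suppose that there are a subset $S'=\{s_1,s_2,s_3,s_4\}\subseteq S$ of four distinct elements and integers $k,k'\geq1$, $\ell\geq 3$ such that $m_{s_1s_2}=2k+1$, $m_{s_2s_3}=\ell$, $m_{s_3s_4}=2k'+1$, $m_{s_4s_1}=\ell$ and $m_{s_1s_3}=m_{s_2s_4}=2$. Let $W'=\langle S'\rangle$. Let $c$ be a Coxeter element of $W$ whose restriction $c'$ to $W'$ is equal to $s_3s_1s_2s_4$. Then $[1,c]_T$ fails to be a lattice.
   Context: $m_{ss'}$ denotes the order of $ss'$ in $W$. $T=\bigcup_{w\in W} wSw^{-1}$ is the set of reflections of $W$. The reflection length $\ell_T(w)$ is the smallest $j\ge 0$ such that $w$ is a product of $j$ elements of $T$. The absolute order is the partial order on $W$ defined by $u\leq_T v \iff \ell_T(u)+\ell_T(u^{-1}v)=\ell_T(v)$. A Coxeter element is a product of all the elements of $S$, each occurring exactly once, in some order. $[1,c]_T=\{x\in W\mid x\leq_T c\}$, ordered by $\leq_T$. The restriction of a Coxeter element $c$ to the standard parabolic subgroup $W'=\langle S'\rangle$ is the Coxeter element $c'$ of $(W',S')$ obtained by removing, from an $S$-reduced expression of $c$ (a word in $S$ of minimal length representing $c$), the letters which are not in $S'$. *)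

theory Defs
  imports "HOL-Algebra.Multiplicative_Group" "HOL-Algebra.Generated_Groups" "HOL-Algebra.Lattice"
begin

definition word_prod :: "('a, 'b) monoid_scheme \<Rightarrow> 'a list \<Rightarrow> 'a" where
  "word_prod G ws = foldr (\<otimes>\<^bsub>G\<^esub>) ws \<one>\<^bsub>G\<^esub>"

text \<open>The order of the product of two generators. The library's \<open>ord\<close> is 0 on elements
  of infinite order, so the value 0 stands for infinity.\<close>

definition coxeter_m :: "('a, 'b) monoid_scheme \<Rightarrow> 'a \<Rightarrow> 'a \<Rightarrow> nat" where
  "coxeter_m W s s' = group.ord W (s \<otimes>\<^bsub>W\<^esub> s')"

text \<open>One insertion of a Coxeter relator \<open>(s s')^m(s,s')\<close> into a word over \<open>S\<close>. If
  \<open>m(s,s')\<close> is infinite (encoded as 0), the inserted word is empty, so no relation is imposed.\<close>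

inductive insert_relator :: "('a, 'b) monoid_scheme \<Rightarrow> 'a set \<Rightarrow> 'a list \<Rightarrow> 'a list \<Rightarrow> bool"
  for W S where
  "u \<in> lists S \<Longrightarrow> v \<in> lists S \<Longrightarrow> s \<in> S \<Longrightarrow> s' \<in> S \<Longrightarrow>
     insert_relator W S (u @ v) (u @ concat (replicate (coxeter_m W s s') [s, s']) @ v)"

text \<open>The generators have order 2, and the relations \<open>(s s')^m(s,s') = 1\<close>, where \<open>m(s,s')\<close>
  is the order of \<open>s s'\<close> whenever this is finite, present the group. Since these relations
  include \<open>s s = 1\<close>, no formal inverses of generators are needed: the presented group is the
  set of words over \<open>S\<close> modulo insertion and deletion of relators.\<close>

locale coxeter_system = group W for W (structure) +
  fixes S :: "'a set"
  assumes S_closed: "S \<subseteq> carrier W"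
    and S_generates: "generate W S = carrier W"
    and S_order_two: "\<And>s. s \<in> S \<Longrightarrow> ord s = 2"
    and presentation: "\<And>ws. ws \<in> lists S \<Longrightarrow>
          word_prod W ws = \<one> \<longleftrightarrow> equivclp (insert_relator W S) ws []"

definition reflections :: "('a, 'b) monoid_scheme \<Rightarrow> 'a set \<Rightarrow> 'a set" where
  "reflections W S = {w \<otimes>\<^bsub>W\<^esub> s \<otimes>\<^bsub>W\<^esub> inv\<^bsub>W\<^esub> w | w s. w \<in> carrier W \<and> s \<in> S}"

text \<open>The minimal length of a word over \<open>A\<close> representing \<open>w\<close>; only meaningful when such a
  word exists.\<close>

definition word_length :: "('a, 'b) monoid_scheme \<Rightarrow> 'a set \<Rightarrow> 'a \<Rightarrow> nat" where
  "word_length G A w = (LEAST j. \<exists>ws \<in> lists A. length ws = j \<and> word_prod G ws = w)"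

definition reflection_length :: "('a, 'b) monoid_scheme \<Rightarrow> 'a set \<Rightarrow> 'a \<Rightarrow> nat" where
  "reflection_length W S w = word_length W (reflections W S) w"

definition absolute_le :: "('a, 'b) monoid_scheme \<Rightarrow> 'a set \<Rightarrow> 'a \<Rightarrow> 'a \<Rightarrow> bool" where
  "absolute_le W S u v \<longleftrightarrow>
     reflection_length W S u + reflection_length W S (inv\<^bsub>W\<^esub> u \<otimes>\<^bsub>W\<^esub> v) = reflection_length W S v"

definition absolute_interval :: "('a, 'b) monoid_scheme \<Rightarrow> 'a set \<Rightarrow> 'a \<Rightarrow> 'a gorder" where
  "absolute_interval W S c =
     \<lparr>carrier = {x \<in> carrier W. absolute_le W S x c}, eq = (=), le = absolute_le W S\<rparr>"

definition coxeter_element :: "('a, 'b) monoid_scheme \<Rightarrow> 'a set \<Rightarrow> 'a \<Rightarrow> bool" where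
  "coxeter_element W S c \<longleftrightarrow> (\<exists>ws. distinct ws \<and> set ws = S \<and> word_prod W ws = c)"

definition reduced_expression :: "('a, 'b) monoid_scheme \<Rightarrow> 'a set \<Rightarrow> 'a \<Rightarrow> 'a list \<Rightarrow> bool" where
  "reduced_expression W S w ws \<longleftrightarrow>
     ws \<in> lists S \<and> word_prod W ws = w \<and> length ws = word_length W S w"

text \<open>For a Coxeter element \<open>c\<close> the element \<open>c'\<close> does not depend on the chosen reduced
  expression, hence the formulation as a relation.\<close>

definition restricts_to :: "('a, 'b) monoid_scheme \<Rightarrow> 'a set \<Rightarrow> 'a set \<Rightarrow> 'a \<Rightarrow> 'a \<Rightarrow> bool" where
  "restricts_to W S S' c c' \<longleftrightarrow>
     (\<exists>ws. reduced_expression W S c ws \<and> word_prod W (filter (\<lambda>s. s \<in> S') ws) = c')"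

text \<open>The locale \<open>lattice\<close> includes the partial order axioms. They hold for the interval
  (\<open>partial_order_absolute_interval\<close> below), so failing to be a lattice means that two
  elements lack a join or a meet.\<close>

context coxeter_system
begin

lemma word_prod_closed: "set ws \<subseteq> carrier W \<Longrightarrow> word_prod W ws \<in> carrier W"
  by (induction ws) (auto simp: word_prod_def)

lemma word_prod_append:
  "set us \<subseteq> carrier W \<Longrightarrow> set vs \<subseteq> carrier W \<Longrightarrow>
   word_prod W (us @ vs) = word_prod W us \<otimes> word_prod W vs"
proof (induction us)
  case Nil
  then show ?case using word_prod_closed[of vs] by (simp add: word_prod_def)
next
  case (Cons a us)
  then show ?case
    using word_prod_closed[of vs] word_prod_closed[of us] by (simp add: word_prod_def m_assoc)
qed

lemma reflections_closed: "reflections W S \<subseteq> carrier W"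
  using S_closed by (auto simp: reflections_def)

lemma S_subset_reflections: "S \<subseteq> reflections W S"
proof
  fix s assume "s \<in> S"
  moreover have "s = \<one> \<otimes> s \<otimes> inv \<one>" using \<open>s \<in> S\<close> S_closed by auto
  ultimately show "s \<in> reflections W S" unfolding reflections_def by blast
qed

lemma inv_S: assumes "s \<in> S" shows "inv s = s"
proof -
  have s: "s \<in> carrier W" using assms S_closed by auto
  have "s [^] (2::nat) = \<one>" using S_order_two[OF assms] s pow_eq_id by simp
  then have "s \<otimes> s = \<one>" using s by (simp add: numeral_2_eq_2)
  then show ?thesis using s by (simp add: inv_equality)
qed

lemma word_exists:
  assumes "w \<in> carrier W" shows "\<exists>ws \<in> lists S. word_prod W ws = w"
proof -
  have "w \<in> generate W S" using assms S_generates by simp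
  then show ?thesis
  proof induction
    case one
    then show ?case by (intro bexI[of _ "[]"]) (auto simp: word_prod_def)
  next
    case (incl h)
    then show ?case using S_closed by (intro bexI[of _ "[h]"]) (auto simp: word_prod_def)
  next
    case (inv h)
    then show ?case using S_closed by (intro bexI[of _ "[h]"]) (auto simp: word_prod_def inv_S)
  next
    case (eng h1 h2)
    then obtain us vs where "us \<in> lists S" "word_prod W us = h1" "vs \<in> lists S" "word_prod W vs = h2"
      by blast
    then show ?case using S_closed word_prod_append[of us vs]
      by (intro bexI[of _ "us @ vs"]) (auto simp: subset_iff)
  qed
qed

lemma reflection_length_witness:
  assumes "w \<in> carrier W"
  obtains ts where "ts \<in> lists (reflections W S)" "length ts = reflection_length W S w" "word_prod W ts = w"
proof -
  have "\<exists>j. \<exists>ws \<in> lists (reflections W S). length ws = j \<and> word_prod W ws = w"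
    using word_exists[OF assms] S_subset_reflections lists_mono[of S "reflections W S"] by blast
  from LeastI_ex[OF this] show thesis
    using that unfolding reflection_length_def word_length_def by blast
qed

lemma reflection_length_le:
  "ts \<in> lists (reflections W S) \<Longrightarrow> reflection_length W S (word_prod W ts) \<le> length ts"
  unfolding reflection_length_def word_length_def by (rule Least_le) blast

lemma reflection_length_mult:
  assumes "u \<in> carrier W" "v \<in> carrier W"
  shows "reflection_length W S (u \<otimes> v) \<le> reflection_length W S u + reflection_length W S v"
proof -
  obtain us where us: "us \<in> lists (reflections W S)" "length us = reflection_length W S u" "word_prod W us = u"
    using assms reflection_length_witness by blast
  obtain vs where vs: "vs \<in> lists (reflections W S)" "length vs = reflection_length W S v" "word_prod W vs = v"
    using assms reflection_length_witness by blast
  have "word_prod W (us @ vs) = u \<otimes> v"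
    using us vs reflections_closed by (subst word_prod_append) auto
  then show ?thesis using reflection_length_le[of "us @ vs"] us vs by simp
qed

lemma reflection_length_eq_0:
  assumes "w \<in> carrier W" shows "reflection_length W S w = 0 \<longleftrightarrow> w = \<one>"
proof
  assume "reflection_length W S w = 0"
  with reflection_length_witness[OF assms] show "w = \<one>" by (force simp: word_prod_def)
next
  assume "w = \<one>"
  then show "reflection_length W S w = 0"
    using reflection_length_le[of "[]"] by (simp add: word_prod_def)
qed

lemma partial_order_absolute_interval: "partial_order (absolute_interval W S c)"
proof -
  have refl: "absolute_le W S x x" if "x \<in> carrier W" for x
    using that reflection_length_eq_0[of \<one>] by (simp add: absolute_le_def)
  have antisym: "x = y" if "absolute_le W S x y" "absolute_le W S y x" "x \<in> carrier W" "y \<in> carrier W" for x y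
  proof -
    have "reflection_length W S (inv x \<otimes> y) = 0" using that by (simp add: absolute_le_def)
    then have "inv x \<otimes> y = \<one>" using that reflection_length_eq_0 by simp
    then show ?thesis using that by (metis inv_closed inv_equality inv_inv)
  qed
  have trans: "absolute_le W S x z"
    if xy: "absolute_le W S x y" and yz: "absolute_le W S y z"
      and [simp]: "x \<in> carrier W" "y \<in> carrier W" "z \<in> carrier W" for x y z
  proof -
    have 1: "(inv x \<otimes> y) \<otimes> (inv y \<otimes> z) = inv x \<otimes> z"
      by (metis inv_closed m_assoc m_closed r_inv r_one that(3-5))
    have 2: "x \<otimes> (inv x \<otimes> z) = z" by (simp add: m_assoc[symmetric])
    show ?thesis
      using xy yz reflection_length_mult[of "inv x \<otimes> y" "inv y \<otimes> z"]
        reflection_length_mult[of x "inv x \<otimes> z"]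
      unfolding absolute_le_def 1 2 by simp
  qed
  show ?thesis
    by unfold_locales (auto simp: absolute_interval_def intro: refl antisym trans)
qed

end

end

theory Submission
  imports "HOL-Analysis.Finite_Function_Topology" Defs
begin

text \<open>The obstruction to being a lattice is a bowtie: two reflections \<open>p \<noteq> q\<close>, both below
two elements \<open>y1 \<noteq> y2\<close> of reflection length 3, such that no element of reflection
length 2 lies above \<open>p\<close> and \<open>q\<close> and below \<open>y1\<close>. A meet of
\<open>y1\<close> and \<open>y2\<close> would have to be such an element.

Because \<open>m(s1,s2)\<close> and \<open>m(s3,s4)\<close> are odd, the longest elements \<open>p\<close> and
\<open>q\<close> of the dihedral groups generated by \<open>s1, s2\<close> and by \<open>s3, s4\<close> are
reflections; \<open>p\<close> exchanges \<open>s1\<close> with \<open>s2\<close> by conjugation, and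
\<open>q\<close> exchanges \<open>s3\<close> with \<open>s4\<close>. Let \<open>g1\<close> and \<open>g2\<close> be
the conjugates of \<open>p\<close> and \<open>q\<close> by \<open>s2 s4\<close>. These exchange relations and the
two commutations are enough to write \<open>c'\<close> in four ways as a product of four reflections,
starting with \<open>p\<close> or \<open>q\<close> and ending with \<open>g1\<close> or \<open>g2\<close>
(\<open>bowtie_factorizations\<close>). So \<open>p\<close> and \<open>q\<close> are below both
\<open>y1 = c' g1\<close> and \<open>y2 = c' g2\<close>.

That nothing of length 2 lies between is seen in the geometric representation. The roots of \<open>p\<close>
and \<open>q\<close> are proportional to \<open>\<alpha> s1 + \<alpha> s2\<close> and \<open>\<alpha> s3 + \<alpha> s4\<close>. If
\<open>m = p t = q t'\<close> were an element in between, then the root of \<open>t\<close> would lie in the plane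
of these two vectors. It would also be orthogonal to a certain vector \<open>u\<close> on which \<open>c'\<close> and
\<open>p\<close> agree. This determines the root \<open>a\<close> up to a factor, and its norm \<open>B a a\<close> turns out to be
a positive multiple of \<open>(2 - y) (2 - z) - x\<^sup>2\<close>, where \<open>x, y, z\<close> are
\<open>2 cos (\<pi> / l)\<close>, \<open>2 cos (\<pi> / (2 k + 1))\<close> and \<open>2 cos (\<pi> / (2 k' + 1))\<close>.
All three numbers lie between 1 and 2, so this is not positive, whereas a root has norm 2
(\<open>no_rank_two_factorization\<close>).

The argument needs reflection lengths in \<open>W\<close>, and linear independence of the roots in a shortest
factorization of \<open>c'\<close> into reflections. Both follow from the observation that a product of
reflections moves vectors only within the span of their roots, while a product of distinct simple reflections
moves vectors by every combination of its simple roots. The latter can fail in the geometric representation itself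
when the form is degenerate, so the representation is enlarged by a dual basis of the simple roots.\<close>

section \<open>Reflections of a symmetric bilinear form\<close>

locale symmetric_bilinear =
  fixes B :: "'v::real_vector \<Rightarrow> 'v \<Rightarrow> real"
  assumes add_left: "B (x + y) z = B x z + B y z"
    and scale_left: "B (r *\<^sub>R x) z = r * B x z"
    and form_sym: "B x y = B y x"
begin

lemma add_right: "B z (x + y) = B z x + B z y"
  by (metis add_left form_sym)

lemma scale_right: "B z (r *\<^sub>R x) = r * B z x"
  by (metis scale_left form_sym)

lemma zero_left: "B 0 z = 0"
  using scale_left[of 0 0 z] by simp

lemma zero_right: "B z 0 = 0"
  by (metis zero_left form_sym)

lemma minus_left: "B (- x) z = - B x z"
  using scale_left[of "-1" x z] by simp

lemma minus_right: "B z (- x) = - B z x"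
  by (metis minus_left form_sym)

lemma diff_left: "B (x - y) z = B x z - B y z"
  using add_left[of x "- y" z] minus_left by simp

lemma diff_right: "B z (x - y) = B z x - B z y"
  by (metis diff_left form_sym)

lemmas bilinear_simps = add_left add_right scale_left scale_right zero_left zero_right
  minus_left minus_right diff_left diff_right

lemma linear_right: "linear (B z)"
  by (rule linearI) (simp_all add: bilinear_simps)

text \<open>For \<open>B a a = 2\<close> this is the orthogonal reflection with root \<open>a\<close>.\<close>

definition reflect :: "'v \<Rightarrow> 'v \<Rightarrow> 'v" where
  "reflect a v = v - B a v *\<^sub>R a"

lemma linear_reflect: "linear (reflect a)"
  by (rule linearI) (simp_all add: reflect_def bilinear_simps algebra_simps)

lemma reflect_involution: "B a a = 2 \<Longrightarrow> reflect a (reflect a v) = v"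
  by (simp add: reflect_def bilinear_simps algebra_simps flip: scaleR_add_left)

lemma reflect_isometry: "B a a = 2 \<Longrightarrow> B (reflect a u) (reflect a v) = B u v"
  by (simp add: reflect_def bilinear_simps algebra_simps form_sym[of u a])

lemma reflect_fixes: "B a v = 0 \<Longrightarrow> reflect a v = v"
  by (simp add: reflect_def)

text \<open>Up to the factor \<open>sin \<theta>\<close>, these are the vectors of norm \<open>B v v = 2\<close> in the plane
spanned by two roots at angle \<open>\<pi> - \<theta>\<close>, parametrized by their angle. The two reflections act on the angle by
\<open>t \<mapsto> \<pi> - t\<close> and \<open>t \<mapsto> \<pi> - t - 2 \<theta>\<close>, which makes the powers of
their product explicit.\<close>

definition circle_vec :: "'v \<Rightarrow> 'v \<Rightarrow> real \<Rightarrow> real \<Rightarrow> 'v" where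
  "circle_vec a b \<theta> t = sin (t + \<theta>) *\<^sub>R a + sin t *\<^sub>R b"

context
  fixes a b :: 'v and \<theta> :: real
  assumes norm_a: "B a a = 2" and norm_b: "B b b = 2" and angle: "B a b = - 2 * cos \<theta>"
begin

lemma reflect_fst_circle_vec: "reflect a (circle_vec a b \<theta> t) = circle_vec a b \<theta> (pi - t)"
proof -
  have "B a (circle_vec a b \<theta> t) = sin (t + \<theta>) - sin (t - \<theta>)"
    using norm_a angle
    by (simp add: circle_vec_def bilinear_simps sin_add sin_diff algebra_simps)
  moreover have "sin (pi - t + \<theta>) = sin (t - \<theta>)"
    using sin_pi_minus[of "t - \<theta>"] by (simp add: algebra_simps)
  ultimately show ?thesis
    by (simp add: reflect_def circle_vec_def scaleR_left_diff_distrib)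
qed

lemma reflect_snd_circle_vec: "reflect b (circle_vec a b \<theta> t) = circle_vec a b \<theta> (pi - t - 2 * \<theta>)"
proof -
  have s2: "sin (t + 2 * \<theta>) = 2 * cos \<theta> * sin (t + \<theta>) - sin t"
  proof -
    have "sin (t + 2 * \<theta>) = sin ((t + \<theta>) + \<theta>)" "sin t = sin ((t + \<theta>) - \<theta>)"
      by (simp_all add: algebra_simps)
    then show ?thesis unfolding sin_add[of "t + \<theta>"] sin_diff[of "t + \<theta>"] by simp
  qed
  have "B b (circle_vec a b \<theta> t) = sin t - sin (t + 2 * \<theta>)"
    using norm_b angle form_sym[of b a] s2
    by (simp add: circle_vec_def bilinear_simps algebra_simps)
  moreover have "sin (pi - t - 2 * \<theta>) = sin (t + 2 * \<theta>)"
    using sin_pi_minus[of "t + 2 * \<theta>"] by (simp add: algebra_simps)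
  moreover have "sin (pi - t - 2 * \<theta> + \<theta>) = sin (t + \<theta>)"
    using sin_pi_minus[of "t + \<theta>"] by (simp add: algebra_simps)
  ultimately show ?thesis
    by (simp add: reflect_def circle_vec_def scaleR_left_diff_distrib)
qed

lemma rotate_circle_vec:
  "reflect a (reflect b (circle_vec a b \<theta> t)) = circle_vec a b \<theta> (t + 2 * \<theta>)"
  by (simp add: reflect_fst_circle_vec reflect_snd_circle_vec algebra_simps)

lemma rotation_power:
  assumes "B a w = 0" "B b w = 0"
  shows "((reflect a \<circ> reflect b) ^^ n) (w + x *\<^sub>R circle_vec a b \<theta> s + y *\<^sub>R circle_vec a b \<theta> t)
    = w + x *\<^sub>R circle_vec a b \<theta> (s + 2 * n * \<theta>) + y *\<^sub>R circle_vec a b \<theta> (t + 2 * n * \<theta>)"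
proof (induction n)
  case (Suc n)
  have "reflect a (reflect b w) = w" using assms by (simp add: reflect_fixes)
  moreover have "t + 2 * real n * \<theta> + 2 * \<theta> = t + 2 * real (Suc n) * \<theta>" for t
    by (simp add: algebra_simps)
  moreover have "((reflect a \<circ> reflect b) ^^ Suc n) v = reflect a (reflect b (((reflect a \<circ> reflect b) ^^ n) v))" for v
    by simp
  ultimately show ?case
    by (simp only: Suc linear_add[OF linear_reflect]
        linear_scale[OF linear_reflect] rotate_circle_vec)
qed simp

lemma circle_vec_0: "circle_vec a b \<theta> 0 = sin \<theta> *\<^sub>R a"
  and circle_vec_minus: "circle_vec a b \<theta> (- \<theta>) = - sin \<theta> *\<^sub>R b"
  by (simp_all add: circle_vec_def)

text \<open>For \<open>sin \<theta> \<noteq> 0\<close> the form is nondegenerate on the plane of the two roots, so the whole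
space splits into this plane and its orthogonal complement.\<close>

lemma circle_decomposition:
  assumes "sin \<theta> \<noteq> 0"
  obtains w x y where "B a w = 0" "B b w = 0"
    "v = w + x *\<^sub>R circle_vec a b \<theta> 0 + y *\<^sub>R circle_vec a b \<theta> (- \<theta>)"
proof -
  define d where "d = 2 * (sin \<theta>)\<^sup>2"
  have d: "d \<noteq> 0" "d = 2 - 2 * (cos \<theta>)\<^sup>2"
    using assms by (simp add: d_def, simp add: d_def sin_squared_eq)
  \<comment> \<open>The coordinates of the projection onto the plane, by Cramer's rule for the Gram matrix
    of the two roots, whose determinant is \<open>2 * d\<close>.\<close>
  define x where "x = (B a v + cos \<theta> * B b v) / d"
  define y where "y = (B b v + cos \<theta> * B a v) / d"
  define w where "w = v - x *\<^sub>R a - y *\<^sub>R b"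
  have "2 * x - 2 * cos \<theta> * y = (B a v * d) / d"
    unfolding x_def y_def d(2) by (simp add: power2_eq_square algebra_simps flip: diff_divide_distrib)
  then have "B a w = 0"
    using d(1) norm_a angle by (simp add: w_def bilinear_simps algebra_simps)
  moreover have "2 * y - 2 * cos \<theta> * x = (B b v * d) / d"
    unfolding x_def y_def d(2) by (simp add: power2_eq_square algebra_simps flip: diff_divide_distrib)
  then have "B b w = 0"
    using d(1) norm_b angle form_sym[of b a] by (simp add: w_def bilinear_simps algebra_simps)
  moreover have "v = w + (x / sin \<theta>) *\<^sub>R circle_vec a b \<theta> 0
      + (- y / sin \<theta>) *\<^sub>R circle_vec a b \<theta> (- \<theta>)"
    using assms by (simp add: w_def circle_vec_0 circle_vec_minus)
  ultimately show thesis using that by blast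
qed

lemma rotation_order:
  assumes "sin \<theta> \<noteq> 0" "real n * \<theta> = pi"
  shows "((reflect a \<circ> reflect b) ^^ n) v = v"
proof -
  obtain w x y where w: "B a w = 0" "B b w = 0"
    and v: "v = w + x *\<^sub>R circle_vec a b \<theta> 0 + y *\<^sub>R circle_vec a b \<theta> (- \<theta>)"
    using circle_decomposition[OF assms(1)] by metis
  have per: "circle_vec a b \<theta> (t + 2 * real n * \<theta>) = circle_vec a b \<theta> t" for t
  proof -
    have "2 * real n * \<theta> = 2 * pi" using assms(2) by simp
    then show ?thesis
      unfolding circle_vec_def
      using sin_periodic[of t] sin_periodic[of "t + \<theta>"] by (simp only: ac_simps)
  qed
  show ?thesis unfolding v rotation_power[OF w] per by simp
qed

text \<open>In the dihedral group of order \<open>2 (2 k + 1)\<close> the longest element exchanges the two simple roots up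
to sign, so it is the reflection in their sum. The coefficient normalizes this sum, whose norm is
\<open>2 (2 - 2 cos \<theta>)\<close>.\<close>

lemma middle_reflection:
  assumes "sin \<theta> \<noteq> 0" "real (2 * k + 1) * \<theta> = pi"
  shows "((reflect a \<circ> reflect b) ^^ k) (reflect a v)
    = v - ((B a v + B b v) / (2 - 2 * cos \<theta>)) *\<^sub>R (a + b)"
proof -
  obtain w x y where w: "B a w = 0" "B b w = 0"
    and v: "v = w + x *\<^sub>R circle_vec a b \<theta> 0 + y *\<^sub>R circle_vec a b \<theta> (- \<theta>)"
    using circle_decomposition[OF assms(1)] by metis
  have k: "2 * real k * \<theta> = pi - \<theta>" using assms(2) by (simp add: algebra_simps)
  have cos1: "2 - 2 * cos \<theta> \<noteq> 0"
    using assms(1) sin_zero_iff_int2 cos_one_sin_zero[of \<theta>] by force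
  have "reflect a v = w + x *\<^sub>R circle_vec a b \<theta> pi + y *\<^sub>R circle_vec a b \<theta> (pi + \<theta>)"
    using w reflect_fixes[of a w]
    by (simp add: v linear_add[OF linear_reflect] linear_scale[OF linear_reflect] reflect_fst_circle_vec)
  then have "((reflect a \<circ> reflect b) ^^ k) (reflect a v)
      = w + x *\<^sub>R circle_vec a b \<theta> (pi + (pi - \<theta>)) + y *\<^sub>R circle_vec a b \<theta> (pi + \<theta> + (pi - \<theta>))"
    using rotation_power[OF w, of k x pi y "pi + \<theta>"] unfolding k by simp
  also have "\<dots> = w - (x * sin \<theta>) *\<^sub>R b + (y * sin \<theta>) *\<^sub>R a"
    using sin_2pi_minus[of \<theta>] sin_periodic[of \<theta>] by (simp add: circle_vec_def add.commute)
  also have "\<dots> = v - ((x - y) * sin \<theta>) *\<^sub>R (a + b)"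
    by (simp add: v circle_vec_0 circle_vec_minus algebra_simps)
  also have "(x - y) * sin \<theta> = (B a v + B b v) / (2 - 2 * cos \<theta>)"
  proof -
    have "B a v + B b v = ((x - y) * sin \<theta>) * (2 - 2 * cos \<theta>)"
      using w norm_a norm_b angle form_sym[of b a]
      by (simp add: v circle_vec_0 circle_vec_minus bilinear_simps algebra_simps)
    then show ?thesis using cos1 by simp
  qed
  finally show ?thesis .
qed

end

end

section \<open>Reflections and the absolute order\<close>

context coxeter_system
begin

lemma S_carrier: "s \<in> S \<Longrightarrow> s \<in> carrier W"
  using S_closed by auto

lemma S_square: "s \<in> S \<Longrightarrow> s \<otimes> s = \<one>"
  using inv_S r_inv S_carrier by metis

lemma coxeter_m_neq_1:
  assumes "r \<in> S" "s \<in> S" "r \<noteq> s" shows "coxeter_m W r s \<noteq> 1"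
proof
  assume "coxeter_m W r s = 1"
  then have "r \<otimes> s = \<one>"
    using assms S_carrier by (metis coxeter_m_def m_closed pow_ord_eq_1 nat_pow_eone)
  then have "r = inv s" using assms S_carrier inv_equality by metis
  then show False using assms inv_S by metis
qed

lemma coxeter_m_sym:
  assumes "r \<in> S" "s \<in> S" shows "coxeter_m W r s = coxeter_m W s r"
proof -
  have "inv (r \<otimes> s) = s \<otimes> r" using assms S_closed inv_S by (simp add: inv_mult_group subset_iff)
  then show ?thesis
    using assms S_closed ord_inv[of "r \<otimes> s"] by (simp add: coxeter_m_def subset_iff)
qed

lemma word_prod_Nil [simp]: "word_prod W [] = \<one>"
  and word_prod_Cons [simp]: "word_prod W (x # ws) = x \<otimes> word_prod W ws"
  by (simp_all add: word_prod_def)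

lemma word_prod_carrier: "ws \<in> lists S \<Longrightarrow> word_prod W ws \<in> carrier W"
  using word_prod_closed S_closed by blast

lemma word_prod_append_S:
  "us \<in> lists S \<Longrightarrow> ws \<in> lists S \<Longrightarrow> word_prod W (us @ ws) = word_prod W us \<otimes> word_prod W ws"
  using word_prod_append S_closed by blast

lemma word_prod_rev: "ws \<in> lists S \<Longrightarrow> word_prod W (rev ws) = inv (word_prod W ws)"
proof (induction ws)
  case (Cons s ws)
  then have s: "s \<in> S" "ws \<in> lists S" by auto
  then have "rev ws \<in> lists S" by auto
  then show ?case
    using Cons.IH s word_prod_append_S[of "rev ws" "[s]"]
    by (simp add: inv_mult_group word_prod_carrier S_carrier inv_S)
qed simp

lemma reflections_carrier: "t \<in> reflections W S \<Longrightarrow> t \<in> carrier W"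
  using reflections_closed by blast

lemma reflection_word_carrier: "ts \<in> lists (reflections W S) \<Longrightarrow> word_prod W ts \<in> carrier W"
  using word_prod_closed reflections_closed by blast

lemma reflections_conj:
  assumes "t \<in> reflections W S" "w \<in> carrier W"
  shows "w \<otimes> t \<otimes> inv w \<in> reflections W S"
proof -
  obtain x s where x: "x \<in> carrier W" "s \<in> S" "t = x \<otimes> s \<otimes> inv x"
    using assms by (auto simp: reflections_def)
  have "w \<otimes> t \<otimes> inv w = (w \<otimes> x) \<otimes> s \<otimes> inv (w \<otimes> x)"
    using x assms S_carrier by (simp add: inv_mult_group m_assoc)
  then show ?thesis using x assms unfolding reflections_def by blast
qed

lemma reflection_square:
  assumes "t \<in> reflections W S" shows "t \<otimes> t = \<one>"
proof -
  obtain x s where x: "x \<in> carrier W" "s \<in> S" "t = x \<otimes> s \<otimes> inv x"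
    using assms by (auto simp: reflections_def)
  have "s \<otimes> (s \<otimes> inv x) = inv x"
    using x S_carrier S_square by (simp flip: m_assoc)
  moreover have "inv x \<otimes> (x \<otimes> (s \<otimes> inv x)) = s \<otimes> inv x"
    using x S_carrier by (simp flip: m_assoc)
  ultimately show ?thesis using x S_carrier by (simp add: m_assoc)
qed

lemma reflection_inv: "t \<in> reflections W S \<Longrightarrow> inv t = t"
  using reflection_square reflections_carrier inv_equality by blast

lemma reflections_conj_reflection:
  "t \<in> reflections W S \<Longrightarrow> r \<in> reflections W S \<Longrightarrow> r \<otimes> (t \<otimes> r) \<in> reflections W S"
  using reflections_conj[of t r] reflection_inv[of r] reflections_carrier by (simp add: m_assoc)

text \<open>Letters outside the subword can be moved to the right of it; they are conjugated on the way and hence stay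
reflections.\<close>

lemma subword_factor:
  assumes "us \<in> lists S"
  shows "\<exists>ts \<in> lists (reflections W S). length ts = length (filter (\<lambda>s. \<not> P s) us) \<and>
    word_prod W us = word_prod W (filter P us) \<otimes> word_prod W ts"
  using assms
proof (induction us)
  case Nil
  show ?case by (intro bexI[of _ "[]"]) simp_all
next
  case (Cons s us)
  let ?f = "word_prod W (filter P us)"
  obtain ts where ts: "ts \<in> lists (reflections W S)"
    "length ts = length (filter (\<lambda>s. \<not> P s) us)" "word_prod W us = ?f \<otimes> word_prod W ts"
    using Cons by blast
  have f: "?f \<in> carrier W"
    using Cons.hyps by (intro word_prod_carrier) auto
  note c = f S_carrier[OF Cons.hyps(1)] reflection_word_carrier[OF ts(1)]
  show ?case
  proof (cases "P s")
    case True
    then show ?thesis using ts c by (intro bexI[of _ ts]) (simp_all add: m_assoc)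
  next
    case False
    have "inv ?f \<otimes> s \<otimes> ?f \<in> reflections W S"
      using reflections_conj[of s "inv ?f"] S_subset_reflections Cons.hyps(1) f by auto
    moreover have "s \<otimes> (?f \<otimes> word_prod W ts) = ?f \<otimes> ((inv ?f \<otimes> s \<otimes> ?f) \<otimes> word_prod W ts)"
      using c by (simp add: m_assoc) (simp flip: m_assoc)
    ultimately show ?thesis
      using ts False c by (intro bexI[of _ "(inv ?f \<otimes> s \<otimes> ?f) # ts"]) simp_all
  qed
qed

text \<open>If a factorization into reflections is as short as possible, then so are its initial segments, by subadditivity of
the reflection length.\<close>

lemma geodesic_prefix:
  assumes "ts \<in> lists (reflections W S)" "us \<in> lists (reflections W S)"
    and "reflection_length W S (word_prod W (ts @ us)) = length (ts @ us)"
  shows "absolute_le W S (word_prod W ts) (word_prod W (ts @ us))"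
    and "reflection_length W S (word_prod W ts) = length ts"
proof -
  note c = reflection_word_carrier[OF assms(1)] reflection_word_carrier[OF assms(2)]
  have app: "word_prod W (ts @ us) = word_prod W ts \<otimes> word_prod W us"
    using assms reflections_closed by (intro word_prod_append) auto
  have "inv (word_prod W ts) \<otimes> word_prod W (ts @ us) = word_prod W us"
    using c by (simp add: app flip: m_assoc)
  then show "absolute_le W S (word_prod W ts) (word_prod W (ts @ us))"
    "reflection_length W S (word_prod W ts) = length ts"
    using reflection_length_mult[OF c] reflection_length_le[OF assms(1)]
      reflection_length_le[OF assms(2)] assms(3)
    by (simp_all add: absolute_le_def app)
qed

lemma reflection_length_1:
  assumes "w \<in> carrier W" "reflection_length W S w = 1" shows "w \<in> reflections W S"
proof -
  obtain ts where ts: "ts \<in> lists (reflections W S)" "length ts = 1" "word_prod W ts = w"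
    using reflection_length_witness[OF assms(1)] assms(2) by metis
  then obtain t where "ts = [t]" by (metis One_nat_def length_0_conv length_Suc_conv)
  then show ?thesis using ts reflections_carrier by auto
qed

lemma absolute_le_cover:
  assumes "x \<in> carrier W" "y \<in> carrier W" "absolute_le W S x y"
    and "reflection_length W S y = Suc (reflection_length W S x)"
  obtains t where "t \<in> reflections W S" "y = x \<otimes> t"
proof
  show "inv x \<otimes> y \<in> reflections W S"
    using assms by (intro reflection_length_1) (simp_all add: absolute_le_def)
  show "y = x \<otimes> (inv x \<otimes> y)" using assms by (simp flip: m_assoc)
qed

lemma absolute_le_eq:
  assumes "x \<in> carrier W" "y \<in> carrier W" "absolute_le W S x y"
    and "reflection_length W S y \<le> reflection_length W S x"
  shows "x = y"
proof -
  have "inv x \<otimes> y = \<one>"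
    using assms reflection_length_eq_0[of "inv x \<otimes> y"] by (simp add: absolute_le_def)
  then show ?thesis using assms by (metis inv_closed inv_equality inv_inv)
qed

text \<open>A meet \<open>m\<close> of \<open>y1\<close> and \<open>y2\<close> lies above \<open>x1\<close> and \<open>x2\<close>.
It cannot have the length of \<open>x1\<close> and \<open>x2\<close>, since it would equal both of them, nor the
length of \<open>y1\<close> and \<open>y2\<close>, for the same reason.\<close>

lemma not_lattice_if_bowtie:
  assumes x: "x1 \<in> carrier W" "x2 \<in> carrier W" "absolute_le W S x1 c" "absolute_le W S x2 c"
    and y: "y1 \<in> carrier W" "y2 \<in> carrier W" "absolute_le W S y1 c" "absolute_le W S y2 c"
    and le: "absolute_le W S x1 y1" "absolute_le W S x1 y2" "absolute_le W S x2 y1" "absolute_le W S x2 y2"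
    and ne: "x1 \<noteq> x2" "y1 \<noteq> y2"
    and rank: "reflection_length W S x1 = 1" "reflection_length W S x2 = 1"
      "reflection_length W S y1 = 3" "reflection_length W S y2 = 3"
    and none: "\<And>m. m \<in> carrier W \<Longrightarrow> reflection_length W S m = 2 \<Longrightarrow> absolute_le W S x1 m \<Longrightarrow>
      absolute_le W S x2 m \<Longrightarrow> absolute_le W S m y1 \<Longrightarrow> False"
  shows "\<not> lattice (absolute_interval W S c)"
proof
  let ?L = "absolute_interval W S c"
  assume "lattice ?L"
  then interpret L: lattice ?L .
  have car: "x1 \<in> carrier ?L" "x2 \<in> carrier ?L" "y1 \<in> carrier ?L" "y2 \<in> carrier ?L"
    using x y by (simp_all add: absolute_interval_def)
  obtain m where m: "greatest ?L m (Lower ?L {y1, y2})"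
    using L.inf_of_two_exists car by blast
  have "m \<in> carrier ?L" using m by simp
  then have mc: "m \<in> carrier W" by (simp add: absolute_interval_def)
  have "z \<in> Lower ?L {y1, y2} \<Longrightarrow> absolute_le W S z m" for z
    using greatest_le[OF m] by (simp add: absolute_interval_def)
  then have xm: "absolute_le W S x1 m" "absolute_le W S x2 m"
    using car le by (auto simp: Lower_def absolute_interval_def)
  have my: "absolute_le W S m y1" "absolute_le W S m y2"
    using greatest_Lower_below[OF m] car by (auto simp: absolute_interval_def)
  have "reflection_length W S m \<ge> 1" "reflection_length W S m \<le> 3"
    using xm my rank by (simp_all add: absolute_le_def)
  then consider "reflection_length W S m = 1" | "reflection_length W S m = 2" | "reflection_length W S m = 3"
    by linarith
  then show False
  proof cases
    case 1
    then show ?thesis using absolute_le_eq xm x mc rank ne by (metis order_refl)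
  next
    case 2
    then show ?thesis using none mc xm my by blast
  next
    case 3
    then show ?thesis using absolute_le_eq my y mc rank ne by (metis order_refl)
  qed
qed

end

section \<open>The extended geometric representation\<close>

text \<open>The form has the usual Gram matrix on the simple roots \<open>\<alpha> s\<close>: the formula gives 2 on the
diagonal, where \<open>m = 1\<close>, and \<open>- 2\<close> where \<open>m\<close> is infinite, because infinity is
encoded as 0 and \<open>pi / 0 = 0\<close>. The vectors \<open>\<omega> s\<close> are dual to the simple roots, so that
the linear forms \<open>B (\<alpha> s)\<close> are independent even when the Gram matrix is singular.\<close>

locale coxeter_realization = coxeter_system W S + symmetric_bilinear B
  for W (structure) and S :: "'a set" and B :: "'v::real_vector \<Rightarrow> 'v \<Rightarrow> real" +
  fixes \<alpha> \<omega> :: "'a \<Rightarrow> 'v"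
  assumes cartan: "r \<in> S \<Longrightarrow> s \<in> S \<Longrightarrow> B (\<alpha> r) (\<alpha> s) = - 2 * cos (pi / coxeter_m W r s)"
    and dual: "r \<in> S \<Longrightarrow> s \<in> S \<Longrightarrow> B (\<alpha> r) (\<omega> s) = (if r = s then 1 else 0)"
begin

lemma simple_norm: "s \<in> S \<Longrightarrow> B (\<alpha> s) (\<alpha> s) = 2"
  using cartan[of s s] by (simp add: coxeter_m_def S_square)

definition act :: "'a list \<Rightarrow> 'v \<Rightarrow> 'v" where
  "act ws = foldr (\<lambda>s. reflect (\<alpha> s)) ws"

lemma act_Nil [simp]: "act [] v = v"
  and act_Cons [simp]: "act (s # ws) v = reflect (\<alpha> s) (act ws v)"
  and act_append [simp]: "act (us @ ws) v = act us (act ws v)"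
  by (simp_all add: act_def)

lemma linear_act: "linear (act ws)"
proof (induction ws)
  case Nil
  show ?case by (rule linearI) simp_all
next
  case (Cons s ws)
  show ?case
    by (rule linearI)
       (simp_all add: linear_add[OF Cons] linear_scale[OF Cons] linear_add[OF linear_reflect]
          linear_scale[OF linear_reflect])
qed

lemma act_isometry: "ws \<in> lists S \<Longrightarrow> B (act ws u) (act ws v) = B u v"
  by (induction ws) (auto simp: reflect_isometry simple_norm)

lemma act_rev: "ws \<in> lists S \<Longrightarrow> act (rev ws) (act ws v) = v"
  by (induction ws arbitrary: v) (auto simp: reflect_involution simple_norm)

text \<open>For \<open>r \<noteq> s\<close> and finite \<open>m\<close>, the product of the two reflections is a rotation by
\<open>2 \<pi> / m\<close> of the plane of their roots.\<close>

lemma act_relator: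
  assumes "r \<in> S" "s \<in> S"
  shows "act (concat (replicate (coxeter_m W r s) [r, s])) v = v"
proof -
  define m where "m = coxeter_m W r s"
  have pow: "act (concat (replicate n [r, s])) v = ((reflect (\<alpha> r) \<circ> reflect (\<alpha> s)) ^^ n) v" for n v
    by (induction n) simp_all
  consider "m = 0" | "r = s" | "m \<ge> 2"
    using coxeter_m_neq_1[OF assms] unfolding m_def by linarith
  then show ?thesis
  proof cases
    case 1
    then show ?thesis by (simp add: m_def)
  next
    case 2
    then have "m = 1" using assms by (simp add: m_def coxeter_m_def S_square)
    then have "coxeter_m W r s = 1" by (simp add: m_def)
    then show ?thesis using 2 assms by (simp add: reflect_involution simple_norm)
  next
    case 3
    have "sin (pi / m) > 0"
      using 3 by (intro sin_gt_zero) (auto simp: field_simps)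
    moreover have "real m * (pi / m) = pi" using 3 by simp
    ultimately show ?thesis
      using rotation_order[OF simple_norm simple_norm cartan] assms
      unfolding m_def[symmetric] pow by (metis m_def less_numeral_extra(3))
  qed
qed

lemma act_insert_relator: "insert_relator W S us ws \<Longrightarrow> act us = act ws"
  by (auto elim!: insert_relator.cases simp: act_relator fun_eq_iff)

lemma act_trivial:
  assumes "ws \<in> lists S" "word_prod W ws = \<one>"
  shows "act ws v = v"
proof -
  have "equivclp (insert_relator W S) ws []"
    using presentation assms by blast
  then have "act ws = act []"
    by (induction rule: converse_equivclp_induct) (use act_insert_relator in metis)+
  then show ?thesis by simp
qed

lemma act_cong:
  assumes "us \<in> lists S" "ws \<in> lists S" "word_prod W us = word_prod W ws"
  shows "act us v = act ws v"
proof -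
  have "rev ws \<in> lists S" using assms by auto
  then have "word_prod W (rev ws @ us) = \<one>" "rev ws @ us \<in> lists S"
    using assms by (simp_all add: word_prod_append_S word_prod_rev word_prod_carrier)
  then have "act (rev ws) (act us v) = v" using act_trivial by fastforce
  then show ?thesis using act_rev[of "rev ws"] \<open>rev ws \<in> lists S\<close> by (metis rev_rev_ident)
qed

text \<open>By \<open>act_cong\<close>, which rests on the presentation of \<open>W\<close>, the choice of the word is
immaterial, so this is a linear representation of \<open>W\<close>.\<close>

definition rep :: "'a \<Rightarrow> 'v \<Rightarrow> 'v" where
  "rep w = act (SOME ws. ws \<in> lists S \<and> word_prod W ws = w)"

lemma rep_word_prod: "ws \<in> lists S \<Longrightarrow> rep (word_prod W ws) v = act ws v"
  unfolding rep_def
  using someI[of "\<lambda>us. us \<in> lists S \<and> word_prod W us = word_prod W ws" ws]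
  by (intro act_cong) blast+

lemma rep_word:
  assumes "w \<in> carrier W"
  obtains ws where "ws \<in> lists S" "word_prod W ws = w" "\<And>v. rep w v = act ws v"
  using word_exists[OF assms] rep_word_prod by blast

lemma rep_simple: "s \<in> S \<Longrightarrow> rep s v = reflect (\<alpha> s) v"
  using rep_word_prod[of "[s]" v] S_carrier by simp

lemma rep_one [simp]: "rep \<one> v = v"
  using rep_word_prod[of "[]" v] by simp

lemma rep_mult:
  assumes "x \<in> carrier W" "y \<in> carrier W" shows "rep (x \<otimes> y) v = rep x (rep y v)"
proof -
  obtain us where us: "us \<in> lists S" "word_prod W us = x" using word_exists assms by blast
  obtain ws where ws: "ws \<in> lists S" "word_prod W ws = y" using word_exists assms by blast
  have "rep (word_prod W (us @ ws)) v = act (us @ ws) v"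
    using us ws by (intro rep_word_prod) simp
  then show ?thesis
    using us ws rep_word_prod by (simp add: word_prod_append_S) metis
qed

lemma rep_pow: "x \<in> carrier W \<Longrightarrow> rep (x [^] (n::nat)) = rep x ^^ n"
proof (induction n)
  case (Suc n)
  have "rep (x [^] Suc n) v = (rep x ^^ Suc n) v" for v
    using Suc by (subst funpow_Suc_right) (simp add: rep_mult)
  then show ?case by blast
qed (simp add: fun_eq_iff)

lemma linear_rep: "w \<in> carrier W \<Longrightarrow> linear (rep w)"
  by (erule rep_word) (metis linear_act ext)

lemma rep_isometry: "w \<in> carrier W \<Longrightarrow> B (rep w u) (rep w v) = B u v"
  by (erule rep_word) (metis act_isometry)

text \<open>The root of \<open>w s w\<inverse>\<close> is the image under \<open>w\<close> of the root of \<open>s\<close>.\<close>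

lemma rep_reflection:
  assumes "t \<in> reflections W S"
  obtains a where "B a a = 2" "\<And>v. rep t v = reflect a v"
proof -
  obtain w s where w: "w \<in> carrier W" "s \<in> S" "t = w \<otimes> s \<otimes> inv w"
    using assms by (auto simp: reflections_def)
  have inv: "rep w (rep (inv w) v) = v" for v
    using rep_mult[of w "inv w" v] w by simp
  have "rep t v = reflect (rep w (\<alpha> s)) v" for v
  proof -
    have "rep t v = rep w (reflect (\<alpha> s) (rep (inv w) v))"
      using w S_carrier by (simp add: rep_mult rep_simple)
    also have "\<dots> = v - B (\<alpha> s) (rep (inv w) v) *\<^sub>R rep w (\<alpha> s)"
      using linear_rep[OF w(1)] inv by (simp add: reflect_def linear_diff linear_scale)
    also have "B (\<alpha> s) (rep (inv w) v) = B (rep w (\<alpha> s)) v"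
      using rep_isometry[OF w(1), of "\<alpha> s" "rep (inv w) v"] inv by simp
    finally show ?thesis by (simp add: reflect_def)
  qed
  moreover have "B (rep w (\<alpha> s)) (rep w (\<alpha> s)) = 2"
    using w by (simp add: rep_isometry simple_norm)
  ultimately show thesis using that by blast
qed

lemma reflection_roots:
  obtains a where "\<And>t. t \<in> reflections W S \<Longrightarrow> B (a t) (a t) = 2"
    "\<And>t v. t \<in> reflections W S \<Longrightarrow> rep t v = reflect (a t) v"
proof -
  have "\<forall>t\<in>reflections W S. \<exists>a. B a a = 2 \<and> (\<forall>v. rep t v = reflect a v)"
    using rep_reflection by metis
  then show thesis using that by (metis (no_types, lifting))
qed

end

section \<open>Existence of the extended representation\<close>

lemma lookup_scaleR: "Poly_Mapping.lookup (r *\<^sub>R x) i = r * Poly_Mapping.lookup x i"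
  for x :: "'i \<Rightarrow>\<^sub>0 real"
proof -
  have "finite {i. r * Poly_Mapping.lookup x i \<noteq> 0}"
    by (rule finite_subset[OF _ finite_lookup[of x]]) auto
  then show ?thesis by (simp add: scaleR_poly_mapping_def Abs_poly_mapping_inverse)
qed

definition matrix_form :: "'i set \<Rightarrow> ('i \<Rightarrow> 'i \<Rightarrow> real) \<Rightarrow> ('i \<Rightarrow>\<^sub>0 real) \<Rightarrow> ('i \<Rightarrow>\<^sub>0 real) \<Rightarrow> real" where
  "matrix_form I M u v = (\<Sum>i\<in>I. \<Sum>j\<in>I. M i j * Poly_Mapping.lookup u i * Poly_Mapping.lookup v j)"

lemma matrix_form_single:
  assumes "finite I" "i \<in> I" "j \<in> I"
  shows "matrix_form I M (Poly_Mapping.single i 1) (Poly_Mapping.single j 1) = M i j"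
proof -
  have "matrix_form I M (Poly_Mapping.single i 1) (Poly_Mapping.single j 1)
      = (\<Sum>i'\<in>I. \<Sum>j'\<in>I. if j = j' then (if i = i' then M i j else 0) else 0)"
    unfolding matrix_form_def by (intro sum.cong refl) (simp add: lookup_single when_def)
  then show ?thesis using assms by simp
qed

lemma symmetric_bilinear_matrix_form:
  fixes M :: "'i \<Rightarrow> 'i \<Rightarrow> real"
  assumes "\<And>i j. i \<in> I \<Longrightarrow> j \<in> I \<Longrightarrow> M i j = M j i"
  shows "symmetric_bilinear (matrix_form I M)"
proof
  fix u v w :: "'i \<Rightarrow>\<^sub>0 real" and r :: real
  show "matrix_form I M (u + v) w = matrix_form I M u w + matrix_form I M v w"
    by (simp add: matrix_form_def lookup_add algebra_simps sum.distrib)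
  show "matrix_form I M (r *\<^sub>R u) w = r * matrix_form I M u w"
    by (simp add: matrix_form_def lookup_scaleR sum_distrib_left mult.assoc mult.left_commute)
  have "matrix_form I M u v = (\<Sum>j\<in>I. \<Sum>i\<in>I. M i j * Poly_Mapping.lookup u i * Poly_Mapping.lookup v j)"
    unfolding matrix_form_def by (rule sum.swap)
  also have "\<dots> = matrix_form I M v u"
    unfolding matrix_form_def using assms by (intro sum.cong refl) simp
  finally show "matrix_form I M u v = matrix_form I M v u" .
qed

text \<open>The Gram matrix of a basis consisting of the simple roots (\<open>Inl\<close>) and their duals (\<open>Inr\<close>).\<close>

fun extended_cartan :: "('a, 'b) monoid_scheme \<Rightarrow> 'a + 'a \<Rightarrow> 'a + 'a \<Rightarrow> real" where
  "extended_cartan W (Inl r) (Inl s) = - 2 * cos (pi / coxeter_m W r s)"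
| "extended_cartan W (Inl r) (Inr s) = (if r = s then 1 else 0)"
| "extended_cartan W (Inr r) (Inl s) = (if r = s then 1 else 0)"
| "extended_cartan W (Inr r) (Inr s) = 0"

lemma (in coxeter_system) coxeter_realization_exists:
  assumes "finite S"
  shows "coxeter_realization W S (matrix_form (S <+> S) (extended_cartan W))
    (\<lambda>s. Poly_Mapping.single (Inl s) 1) (\<lambda>s. Poly_Mapping.single (Inr s) 1)"
proof -
  have "extended_cartan W i j = extended_cartan W j i" if "i \<in> S <+> S" "j \<in> S <+> S" for i j
    using that coxeter_m_sym by (cases i; cases j) auto
  then interpret symmetric_bilinear "matrix_form (S <+> S) (extended_cartan W)"
    by (rule symmetric_bilinear_matrix_form)
  show ?thesis
    by unfold_locales (use assms in \<open>auto simp: matrix_form_single finite_Plus InlI InrI\<close>)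
qed

section \<open>Reflection length of Coxeter elements\<close>

context coxeter_realization
begin

text \<open>The word is treated letter by letter from the right. Adding a multiple of \<open>\<omega> s\<close> to the vector
adjusts the coefficient of \<open>\<alpha> s\<close> in the displacement and is invisible to the letters other than
\<open>s\<close>. Without the duals the claim would fail, for instance for affine Coxeter groups, whose Coxeter
elements fix a nonzero combination of the simple roots.\<close>

lemma coxeter_word_moves:
  assumes "distinct ws" "ws \<in> lists S" "x \<in> span (\<alpha> ` set ws)"
  shows "\<exists>u. act ws u = u + x"
  using assms
proof (induction ws arbitrary: x)
  case (Cons s ws)
  then have s: "s \<in> S" "s \<notin> set ws" "distinct ws" "ws \<in> lists S" by auto
  obtain k where k: "x - k *\<^sub>R \<alpha> s \<in> span (\<alpha> ` set ws)"
    using Cons.prems(3) span_breakdown_eq[of x "\<alpha> s"] by auto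
  define x' where "x' = x - k *\<^sub>R \<alpha> s"
  obtain u where u: "act ws u = u + x'" using Cons.IH s k x'_def by blast
  have fixed: "act us (\<omega> s) = \<omega> s" if "us \<in> lists S" "s \<notin> set us" for us
    using that by (induction us) (auto simp: reflect_fixes dual s(1))
  define b where "b = - k - B (\<alpha> s) (u + x')"
  have "act ws (u + b *\<^sub>R \<omega> s) = u + b *\<^sub>R \<omega> s + x'"
    using fixed[of ws] s u by (simp add: linear_add[OF linear_act] linear_scale[OF linear_act])
  moreover have "B (\<alpha> s) (u + b *\<^sub>R \<omega> s + x') = - k"
    using s dual[of s s] by (simp add: bilinear_simps b_def)
  ultimately have "act (s # ws) (u + b *\<^sub>R \<omega> s) = (u + b *\<^sub>R \<omega> s) + x"
    by (simp add: reflect_def x'_def)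
  then show ?case by blast
qed simp

lemma simple_root_in_span:
  assumes "s \<in> S" "A \<subseteq> S" "\<alpha> s \<in> span (\<alpha> ` A)" shows "s \<in> A"
proof (rule ccontr)
  assume "s \<notin> A"
  then have "B (\<omega> s) y = 0" if "y \<in> \<alpha> ` A" for y
    using that assms dual form_sym[of "\<omega> s"] by auto
  then have "B (\<omega> s) x = 0" if "x \<in> span (\<alpha> ` A)" for x
    using linear_eq_0_on_span[OF linear_right _ that] by blast
  then show False using assms dual[of s s] form_sym[of "\<omega> s"] by simp
qed

lemma simple_roots_inj: "inj_on \<alpha> S"
proof (rule inj_onI)
  fix r s assume rs: "r \<in> S" "s \<in> S" "\<alpha> r = \<alpha> s"
  then have "\<alpha> r \<in> span (\<alpha> ` {s})" by (simp add: span_base)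
  then show "r = s" using simple_root_in_span[of r "{s}"] rs by simp
qed

lemma simple_roots_independent:
  assumes "A \<subseteq> S" shows "independent (\<alpha> ` A)"
  unfolding dependent_def
proof
  assume "\<exists>a\<in>\<alpha> ` A. a \<in> span (\<alpha> ` A - {a})"
  then obtain s where s: "s \<in> A" "\<alpha> s \<in> span (\<alpha> ` A - {\<alpha> s})" by blast
  have "\<alpha> ` A - {\<alpha> s} \<subseteq> \<alpha> ` (A - {s})" by auto
  then have "\<alpha> s \<in> span (\<alpha> ` (A - {s}))" using s span_mono by blast
  then show False using simple_root_in_span[of s "A - {s}"] s(1) assms by auto
qed

lemma reflection_word_moves:
  assumes "ts \<in> lists (reflections W S)"
    and "\<And>t. t \<in> set ts \<Longrightarrow> \<forall>v. rep t v = reflect (a t) v"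
  shows "rep (word_prod W ts) v - v \<in> span (a ` set ts)"
  using assms
proof (induction ts)
  case Nil
  then show ?case by simp
next
  case (Cons t ts)
  let ?v = "rep (word_prod W ts) v"
  have "word_prod W ts \<in> carrier W"
    using Cons.hyps by (intro reflection_word_carrier) auto
  then have "rep (word_prod W (t # ts)) v = reflect (a t) ?v"
    using Cons.prems Cons.hyps by (simp add: rep_mult reflections_carrier)
  then have "rep (word_prod W (t # ts)) v - v = (?v - v) - B (a t) ?v *\<^sub>R a t"
    by (simp add: reflect_def)
  moreover have "?v - v \<in> span (a ` set (t # ts))"
    using Cons span_mono[of "a ` set ts" "a ` set (t # ts)"] by auto
  moreover have "a t \<in> span (a ` set (t # ts))" by (simp add: span_base)
  ultimately show ?case by (metis span_diff span_scale)
qed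

text \<open>For \<open>R\<close> the roots of a factorization into reflections the hypothesis holds, because every reflection moves
vectors along its root. So the number of factors is at least the dimension of the span of the simple roots of the
word, which is its length.\<close>

lemma coxeter_word_span:
  assumes "distinct ws" "ws \<in> lists S"
    and "\<And>v. rep (word_prod W ws) v - v \<in> span R"
  shows "\<alpha> ` set ws \<subseteq> span R"
proof
  fix x assume "x \<in> \<alpha> ` set ws"
  then obtain u where "act ws u = u + x"
    using coxeter_word_moves[OF assms(1,2)] span_base by metis
  then show "x \<in> span R" using assms(3)[of u] assms(2) by (simp add: rep_word_prod)
qed

lemma coxeter_word_bound:
  assumes "distinct ws" "ws \<in> lists S" "finite R" "\<alpha> ` set ws \<subseteq> span R"
  shows "length ws \<le> card R"
proof -
  have sub: "set ws \<subseteq> S" using assms(2) by auto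
  have "card (\<alpha> ` set ws) \<le> card R"
    using independent_span_bound[OF assms(3) simple_roots_independent[OF sub] assms(4)] by simp
  moreover have "card (\<alpha> ` set ws) = length ws"
    using card_image[OF inj_on_subset[OF simple_roots_inj sub]] assms(1) distinct_card by metis
  ultimately show ?thesis by simp
qed

lemma reflection_length_coxeter_word:
  assumes "distinct ws" "ws \<in> lists S"
  shows "reflection_length W S (word_prod W ws) = length ws"
proof (rule antisym)
  show "reflection_length W S (word_prod W ws) \<le> length ws"
    using assms S_subset_reflections by (intro reflection_length_le) auto
  obtain ts where ts: "ts \<in> lists (reflections W S)" "word_prod W ts = word_prod W ws"
    "length ts = reflection_length W S (word_prod W ws)"
    using reflection_length_witness word_prod_carrier assms by metis
  obtain a where a: "\<And>t v. t \<in> reflections W S \<Longrightarrow> rep t v = reflect (a t) v"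
    by (rule reflection_roots) blast
  have "rep (word_prod W ws) v - v \<in> span (a ` set ts)" for v
    using reflection_word_moves[OF ts(1), of a v] a ts(1,2) by auto
  then have "\<alpha> ` set ws \<subseteq> span (a ` set ts)"
    by (rule coxeter_word_span[OF assms])
  then have "length ws \<le> card (a ` set ts)" using coxeter_word_bound assms by blast
  also have "\<dots> \<le> length ts" using card_image_le[of "set ts" a] card_length[of ts] by simp
  finally show "length ws \<le> reflection_length W S (word_prod W ws)" using ts by simp
qed

text \<open>Every word for a Coxeter element contains all of \<open>S\<close>, since its letters span the displacements of the
element; a shortest word therefore has no repetition.\<close>

lemma reduced_coxeter_word:
  assumes "finite S" "coxeter_element W S c" "reduced_expression W S c us"
  shows "distinct us \<and> set us = S"
proof -
  obtain ws where ws: "distinct ws" "set ws = S" "word_prod W ws = c"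
    using assms(2) by (auto simp: coxeter_element_def)
  have us: "us \<in> lists S" "word_prod W us = c" "length us = word_length W S c"
    using assms(3) by (auto simp: reduced_expression_def)
  have "length us \<le> length ws"
    unfolding us(3) word_length_def using ws by (intro Least_le) auto
  moreover have "set us = S"
  proof
    have "\<alpha> ` set ws \<subseteq> span (\<alpha> ` set us)"
    proof (rule coxeter_word_span[OF ws(1)])
      show "ws \<in> lists S" using ws by auto
      show "rep (word_prod W ws) v - v \<in> span (\<alpha> ` set us)" for v
      proof -
        have "us \<in> lists (reflections W S)" "\<And>t. t \<in> set us \<Longrightarrow> \<forall>v. rep t v = reflect (\<alpha> t) v"
          using us(1) S_subset_reflections rep_simple by auto
        then show ?thesis using reflection_word_moves[of us \<alpha> v] us ws by simp
      qed
    qed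
    then show "S \<subseteq> set us"
      using simple_root_in_span[of _ "set us"] us(1) ws(2) by blast
  qed (use us in auto)
  ultimately show ?thesis
    using ws by (metis card_distinct distinct_card card_length le_antisym)
qed

text \<open>The bridge from \<open>W'\<close> to \<open>W\<close>: a shortest factorization of \<open>c'\<close> into reflections
extends to one of \<open>c\<close>.\<close>

lemma reduced_subword_below:
  assumes "finite S" "coxeter_element W S c" "reduced_expression W S c us"
    and "word_prod W (filter (\<lambda>s. s \<in> S') us) = c'" "S' \<subseteq> S"
  obtains rs where "rs \<in> lists (reflections W S)" "c = c' \<otimes> word_prod W rs"
    "reflection_length W S c = card S' + length rs"
proof -
  have us: "distinct us" "set us = S" using reduced_coxeter_word assms by auto
  then have usS: "us \<in> lists S" by auto
  have c: "word_prod W us = c" using assms(3) by (simp add: reduced_expression_def)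
  obtain rs where rs: "rs \<in> lists (reflections W S)"
    "length rs = length (filter (\<lambda>s. \<not> s \<in> S') us)"
    "word_prod W us = word_prod W (filter (\<lambda>s. s \<in> S') us) \<otimes> word_prod W rs"
    using subword_factor[OF usS, of "\<lambda>s. s \<in> S'"] by blast
  have "length (filter (\<lambda>s. s \<in> S') us) = card (set (filter (\<lambda>s. s \<in> S') us))"
    using us by (metis distinct_card distinct_filter)
  also have "set (filter (\<lambda>s. s \<in> S') us) = S'" using us assms(5) by auto
  finally have "length (filter (\<lambda>s. s \<in> S') us) = card S'" .
  then have "length us = card S' + length rs"
    using rs(2) sum_length_filter_compl[of "\<lambda>s. s \<in> S'" us] by simp
  then show thesis
    using that rs assms(4) c reflection_length_coxeter_word[OF us(1) usS] by simp
qed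

text \<open>The four factors \<open>x, a, b, g\<close> and the remaining word \<open>rs\<close> together form a shortest
factorization of \<open>c\<close>, so all initial segments are comparable.\<close>

lemma prefixes_below:
  assumes "[x, a, b, g] \<in> lists (reflections W S)" "rs \<in> lists (reflections W S)"
    and "word_prod W [x, a, b, g] = c'" "c = c' \<otimes> word_prod W rs"
    and "reflection_length W S c = 4 + length rs"
  shows "absolute_le W S x (c' \<otimes> g)" "absolute_le W S x c" "absolute_le W S (c' \<otimes> g) c"
    "reflection_length W S x = 1" "reflection_length W S (c' \<otimes> g) = 3"
    "c' \<otimes> g = x \<otimes> (a \<otimes> b)" "c' \<otimes> g \<in> carrier W"
proof -
  have r: "x \<in> reflections W S" "a \<in> reflections W S" "b \<in> reflections W S" "g \<in> reflections W S"
    using assms(1) by auto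
  note car = r[THEN reflections_carrier] reflection_word_carrier[OF assms(2)]
  show y: "c' \<otimes> g = x \<otimes> (a \<otimes> b)" "c' \<otimes> g \<in> carrier W"
    using car reflection_square[OF r(4)] by (auto simp: assms(3)[symmetric] m_assoc)
  have c: "c = x \<otimes> (a \<otimes> (b \<otimes> (g \<otimes> word_prod W rs)))"
    using car by (simp add: assms(4) assms(3)[symmetric] m_assoc)
  have gs: "[x] \<in> lists (reflections W S)" "[a, b] @ [g] @ rs \<in> lists (reflections W S)"
    "[x, a, b] \<in> lists (reflections W S)" "[g] @ rs \<in> lists (reflections W S)"
    "[a, b] \<in> lists (reflections W S)"
    using r assms(2) by auto
  show "absolute_le W S x c" "reflection_length W S x = 1"
    using geodesic_prefix[OF gs(1,2)] assms(5) car by (simp_all add: c)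
  show yc: "absolute_le W S (c' \<otimes> g) c" "reflection_length W S (c' \<otimes> g) = 3"
    using geodesic_prefix[OF gs(3,4)] assms(5) car by (simp_all add: c y(1))
  show "absolute_le W S x (c' \<otimes> g)"
    using geodesic_prefix[OF gs(1,5)] yc(2) car by (simp add: y(1))
qed

end

section \<open>No element of reflection length two in between\<close>

context coxeter_realization
begin

text \<open>In a shortest factorization the root of \<open>t\<close> is independent of the roots of the later factors. Hence a
vector fixed by the product of \<open>t\<close> and these factors is fixed by \<open>t\<close> and by their product
separately: the displacements under the two would have to cancel.\<close>

lemma geodesic_fixed_vector:
  assumes ws: "distinct ws" "ws \<in> lists S"
    and ts: "p \<in> reflections W S" "t \<in> reflections W S" "us \<in> lists (reflections W S)"
    and prod: "word_prod W ws = word_prod W (p # t # us)" "length ws = length us + 2"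
    and root: "\<And>r v. r \<in> reflections W S \<Longrightarrow> rep r v = reflect (a r) v"
    and norm: "B (a t) (a t) = 2"
    and fixed: "rep (p \<otimes> word_prod W ws) v = v"
  shows "rep (word_prod W us) v = v" "B (a t) v = 0"
proof -
  \<comment> \<open>Otherwise the simple roots of the word would lie in a span of too few vectors.\<close>
  have at: "a t \<notin> span (a ` set us)"
  proof
    assume at: "a t \<in> span (a ` set us)"
    have "a ` set (p # t # us) \<subseteq> span (insert (a p) (a ` set us))"
      using at span_mono[of "a ` set us" "insert (a p) (a ` set us)"] by (auto intro: span_base)
    moreover have "\<alpha> ` set ws \<subseteq> span (a ` set (p # t # us))"
    proof (rule coxeter_word_span[OF ws])
      have "p # t # us \<in> lists (reflections W S)" using ts by simp
      then show "rep (word_prod W ws) v - v \<in> span (a ` set (p # t # us))" for v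
        unfolding prod(1) using root by (intro reflection_word_moves) auto
    qed
    ultimately have "\<alpha> ` set ws \<subseteq> span (insert (a p) (a ` set us))"
      by (meson span_minimal subspace_span subset_trans)
    then have "length ws \<le> card (insert (a p) (a ` set us))"
      using ws by (intro coxeter_word_bound) simp_all
    also have "\<dots> \<le> Suc (length us)"
      using card_insert_le_m1 card_image_le[of "set us" a] card_length[of us]
      by (simp add: card_insert_if)
    finally show False using prod(2) by simp
  qed
  define x where "x = rep (word_prod W us) v"
  have usc: "word_prod W us \<in> carrier W" using ts(3) by (rule reflection_word_carrier)
  have "p \<otimes> word_prod W ws = t \<otimes> word_prod W us"
    using ts usc reflection_square[OF ts(1)]
    by (simp add: prod(1) reflections_carrier flip: m_assoc)
  then have "reflect (a t) x = v"
    using fixed ts usc by (simp add: x_def rep_mult reflections_carrier root)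
  then have x: "x - v = B (a t) x *\<^sub>R a t" by (simp add: reflect_def algebra_simps)
  have "x - v \<in> span (a ` set us)"
    unfolding x_def using ts root by (intro reflection_word_moves) auto
  have "B (a t) x = 0"
  proof (rule ccontr)
    assume nz: "B (a t) x \<noteq> 0"
    have "a t = (1 / B (a t) x) *\<^sub>R (x - v)" using nz by (simp add: x)
    then show False using at \<open>x - v \<in> span (a ` set us)\<close> span_scale by metis
  qed
  then show "rep (word_prod W us) v = v" "B (a t) v = 0"
    using x by (simp_all add: x_def)
qed

text \<open>The vectors \<open>up\<close> and \<open>uq\<close> are chosen so that \<open>c'\<close> moves them exactly as \<open>p\<close>
and \<open>q\<close> do, namely by the roots \<open>bp\<close> and \<open>bq\<close>. Then \<open>t\<close> fixes
\<open>up\<close>, and \<open>p t\<close> moves \<open>uq\<close> by \<open>bq\<close>. The second fact places the root of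
\<open>t\<close> in the plane of \<open>bp\<close> and \<open>bq\<close>, the first one determines its direction there,
and the norm in this direction is not positive.\<close>

lemma no_rank_two_factorization:
  fixes x y z :: real
  assumes S: "s1 \<in> S" "s2 \<in> S" "s3 \<in> S" "s4 \<in> S" "distinct [s1, s2, s3, s4]"
    and form: "B (\<alpha> s1) (\<alpha> s2) = - y" "B (\<alpha> s3) (\<alpha> s4) = - z" "B (\<alpha> s1) (\<alpha> s3) = 0"
      "B (\<alpha> s2) (\<alpha> s4) = 0" "B (\<alpha> s2) (\<alpha> s3) = - x" "B (\<alpha> s4) (\<alpha> s1) = - x"
    and bounds: "y < 2" "z < 2" "(2 - y) * (2 - z) \<le> x\<^sup>2"
    and pq: "p \<in> reflections W S" "q \<in> reflections W S"
      "\<And>v. rep p v = v - ((B (\<alpha> s1) v + B (\<alpha> s2) v) / (2 - y)) *\<^sub>R (\<alpha> s1 + \<alpha> s2)"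
      "\<And>v. rep q v = v - ((B (\<alpha> s3) v + B (\<alpha> s4) v) / (2 - z)) *\<^sub>R (\<alpha> s3 + \<alpha> s4)"
    and m: "t \<in> reflections W S" "t' \<in> reflections W S" "u \<in> reflections W S" "g \<in> reflections W S"
      "p \<otimes> t = q \<otimes> t'" "word_prod W [s3, s1, s2, s4] = word_prod W [p, t, u, g]"
  shows False
proof -
  obtain a where norm: "\<And>t. t \<in> reflections W S \<Longrightarrow> B (a t) (a t) = 2"
    and root: "\<And>t v. t \<in> reflections W S \<Longrightarrow> rep t v = reflect (a t) v"
    by (rule reflection_roots) blast
  let ?c = "word_prod W [s3, s1, s2, s4]"
  define bp where "bp = \<alpha> s1 + \<alpha> s2"
  define bq where "bq = \<alpha> s3 + \<alpha> s4"
  \<comment> \<open>The solutions of \<open>c' v = v - bp\<close> and \<open>c' v = v - bq\<close>: going through the letters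
    \<open>s4, s2, s1, s3\<close> of \<open>c'\<close>, each must contribute its simple root with coefficient 0 or
    1, which prescribes the values of the forms \<open>B (\<alpha> si)\<close> one after the other.\<close>
  define up where "up = (1 - y) *\<^sub>R \<omega> s1 + \<omega> s2 - x *\<^sub>R \<omega> s3"
  define uq where "uq = (1 - z) *\<^sub>R \<omega> s3 + \<omega> s4 - x *\<^sub>R \<omega> s1"
  have form': "B (\<alpha> s2) (\<alpha> s1) = - y" "B (\<alpha> s4) (\<alpha> s3) = - z" "B (\<alpha> s3) (\<alpha> s1) = 0"
      "B (\<alpha> s4) (\<alpha> s2) = 0" "B (\<alpha> s3) (\<alpha> s2) = - x" "B (\<alpha> s1) (\<alpha> s4) = - x"
    using form form_sym by metis+
  note forms = form form' simple_norm[OF S(1)] simple_norm[OF S(2)] simple_norm[OF S(3)] simple_norm[OF S(4)]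
  have up: "B (\<alpha> s1) up = 1 - y" "B (\<alpha> s2) up = 1" "B (\<alpha> s3) up = - x" "B (\<alpha> s4) up = 0"
    and uq: "B (\<alpha> s1) uq = - x" "B (\<alpha> s2) uq = 0" "B (\<alpha> s3) uq = 1 - z" "B (\<alpha> s4) uq = 1"
    using S by (auto simp: up_def uq_def bilinear_simps dual)
  have c: "rep ?c v = reflect (\<alpha> s3) (reflect (\<alpha> s1) (reflect (\<alpha> s2) (reflect (\<alpha> s4) v)))" for v
    using S by (subst rep_word_prod) simp_all
  have cup: "rep ?c up = up - bp"
    unfolding c using up forms by (simp add: reflect_def bilinear_simps bp_def algebra_simps)
  have cuq: "rep ?c uq = uq - bq"
    unfolding c using uq forms by (simp add: reflect_def bilinear_simps bq_def algebra_simps)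
  have p_up: "rep p up = up - bp" using up bounds by (simp add: pq bp_def)
  have q_uq: "rep q uq = uq - bq" using uq bounds by (simp add: pq bq_def)
  have car: "p \<in> carrier W" "q \<in> carrier W" "t \<in> carrier W" "t' \<in> carrier W" "u \<in> carrier W" "g \<in> carrier W"
    "?c \<in> carrier W"
    using pq m S reflections_carrier by (auto intro!: word_prod_carrier)
  have inv: "rep r (rep r v) = v" if "r \<in> reflections W S" for r v
    using rep_mult[of r r v] reflection_square[OF that] reflections_carrier[OF that] by simp
  have words: "distinct [s3, s1, s2, s4]" "[s3, s1, s2, s4] \<in> lists S" using S by auto
  have ug: "[u, g] \<in> lists (reflections W S)" using m by simp
  have fix_p: "B (a t) up = 0"
  proof (rule geodesic_fixed_vector(2)[OF words pq(1) m(1) ug m(6) _ root norm[OF m(1)]])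
    show "rep (p \<otimes> ?c) up = up" using car inv[OF pq(1), of up] by (simp only: rep_mult cup p_up)
  qed simp_all
  \<comment> \<open>The factorizations \<open>c' = p t u g\<close> and \<open>c' = q t' u g\<close> both end with
    \<open>u g\<close>. The second one shows that \<open>u g\<close> fixes \<open>uq\<close>, and the first one then
    gives \<open>c' uq = p t uq\<close>.\<close>
  have fix_q: "rep (word_prod W [u, g]) uq = uq"
  proof (rule geodesic_fixed_vector(1)[OF words pq(2) m(2) ug _ _ root norm[OF m(2)]])
    show "rep (q \<otimes> ?c) uq = uq" using car inv[OF pq(2), of uq] by (simp only: rep_mult cuq q_uq)
    have "word_prod W [p, t, u, g] = (p \<otimes> t) \<otimes> word_prod W [u, g]"
      using car by (simp add: m_assoc)
    then show "?c = word_prod W [q, t', u, g]"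
      unfolding m(5,6) using car by (simp add: m_assoc)
  qed simp_all
  have "rep ?c uq = rep p (rep t uq)"
  proof -
    have "?c = p \<otimes> (t \<otimes> word_prod W [u, g])" unfolding m(6) by simp
    then show ?thesis using car fix_q by (simp add: rep_mult)
  qed
  then have "uq - bq = rep p (rep t uq)" using cuq by simp
  then have "bq = B (a t) uq *\<^sub>R a t
      + ((B (\<alpha> s1) (rep t uq) + B (\<alpha> s2) (rep t uq)) / (2 - y)) *\<^sub>R bp"
    unfolding pq(3) bp_def[symmetric] by (simp add: root[OF m(1)] reflect_def algebra_simps)
  then obtain \<kappa> \<mu> where bq: "bq = \<kappa> *\<^sub>R a t + \<mu> *\<^sub>R bp"
    by blast
  have "B bq up = \<mu> * B bp up" using fix_p by (simp add: bq bilinear_simps)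
  then have mu: "\<mu> * (2 - y) = - x" using up by (simp add: bq_def bp_def bilinear_simps algebra_simps)
  \<comment> \<open>\<open>bq\<close> is not a multiple of \<open>bp\<close>.\<close>
  have k0: "\<kappa> \<noteq> 0"
  proof
    assume "\<kappa> = 0"
    then have "B bq (\<omega> s3) = \<mu> * B bp (\<omega> s3)" by (simp add: bq bilinear_simps)
    then show False using S by (auto simp: bq_def bp_def bilinear_simps dual)
  qed
  have "\<kappa>\<^sup>2 * 2 = B (\<kappa> *\<^sub>R a t) (\<kappa> *\<^sub>R a t)"
    using norm[OF m(1)] by (simp add: bilinear_simps power2_eq_square)
  also have "\<kappa> *\<^sub>R a t = bq - \<mu> *\<^sub>R bp" by (simp add: bq)
  also have "B (bq - \<mu> *\<^sub>R bp) (bq - \<mu> *\<^sub>R bp) = 2 * (2 - z) + 4 * \<mu> * x + 2 * \<mu>\<^sup>2 * (2 - y)"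
    using forms by (simp add: bq_def bp_def bilinear_simps power2_eq_square algebra_simps)
  also have "\<dots> = 2 * (2 - z) + 2 * (\<mu> * x)"
  proof -
    have "2 * \<mu>\<^sup>2 * (2 - y) = 2 * \<mu> * (\<mu> * (2 - y))" by (simp add: power2_eq_square)
    also have "\<dots> = - 2 * (\<mu> * x)" unfolding mu by simp
    finally show ?thesis by linarith
  qed
  also have "\<dots> = 2 * ((2 - z) + \<mu> * x)" by simp
  finally have "2 * ((2 - z) + \<mu> * x) = \<kappa>\<^sup>2 * 2" by (rule sym)
  then have "0 < 2 * ((2 - z) + \<mu> * x)" using k0 by simp
  then have "0 < (2 - z) + \<mu> * x" by simp
  then have "0 < (2 - y) * ((2 - z) + \<mu> * x)" using bounds by simp
  also have "\<dots> = (2 - y) * (2 - z) + (\<mu> * (2 - y)) * x" by (simp add: algebra_simps)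
  also have "\<dots> \<le> 0" using bounds unfolding mu by (simp add: power2_eq_square)
  finally show False by simp
qed

end

section \<open>The bowtie\<close>

lemma two_cos_ge_1:
  fixes n :: nat assumes "n \<ge> 3" shows "1 \<le> 2 * cos (pi / n)" "2 * cos (pi / n) < 2"
proof -
  have n: "pi / n \<le> pi / 3" using assms by (intro divide_left_mono) simp_all
  have "cos (pi / 3) \<le> cos (pi / n)"
  proof (rule cos_monotone_0_pi_le[OF _ n])
    show "pi / 3 \<le> pi" using pi_gt_zero by linarith
  qed simp
  then show "1 \<le> 2 * cos (pi / n)" by (simp add: cos_60)
  have "cos (pi / n) < cos 0"
  proof (rule cos_monotone_0_pi)
    show "pi / n \<le> pi" using n pi_gt_zero by linarith
  qed (use assms in simp_all)
  then show "2 * cos (pi / n) < 2" by simp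
qed

context coxeter_system
begin

lemma pow_shift:
  assumes "r \<in> carrier W" "s \<in> carrier W"
  shows "(r \<otimes> s) [^] (n::nat) \<otimes> r = r \<otimes> (s \<otimes> r) [^] n"
proof (induction n)
  case (Suc n)
  have "(r \<otimes> s) [^] Suc n \<otimes> r = ((r \<otimes> s) [^] n \<otimes> r) \<otimes> (s \<otimes> r)"
    using assms by (simp add: m_assoc)
  also have "\<dots> = r \<otimes> (s \<otimes> r) [^] Suc n"
    using assms Suc by (simp add: m_assoc)
  finally show ?case .
qed (use assms in simp)

text \<open>The alternating word of odd length is a palindrome, so it is a conjugate of its middle letter.\<close>

lemma alternating_reflection:
  "r \<in> S \<Longrightarrow> s \<in> S \<Longrightarrow> (r \<otimes> s) [^] (k::nat) \<otimes> r \<in> reflections W S"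
proof (induction k arbitrary: r s)
  case 0
  then show ?case using S_subset_reflections S_carrier by auto
next
  case (Suc k)
  note c = S_carrier[OF Suc.prems(1)] S_carrier[OF Suc.prems(2)]
  have "(r \<otimes> s) [^] Suc k \<otimes> r = r \<otimes> ((s \<otimes> r) [^] k \<otimes> s) \<otimes> r"
    using c pow_shift[of r s "Suc k"] by (simp add: m_assoc)
  then show ?case
    using reflections_conj[OF Suc.IH[of s r], of r] Suc.prems c inv_S by simp
qed

text \<open>When \<open>r s\<close> has order \<open>2 k + 1\<close>, its \<open>k\<close>-th power is the inverse of its
\<open>(k + 1)\<close>-st power.\<close>

lemma alternating_swap:
  assumes "r \<in> S" "s \<in> S" "coxeter_m W r s = 2 * k + 1"
  shows "(r \<otimes> s) [^] k \<otimes> r \<otimes> r = s \<otimes> ((r \<otimes> s) [^] k \<otimes> r)"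
proof -
  note c = S_carrier[OF assms(1)] S_carrier[OF assms(2)]
  have rs: "r \<otimes> s \<in> carrier W" using c by simp
  have inv: "inv (r \<otimes> s) = s \<otimes> r" using assms c by (simp add: inv_mult_group inv_S)
  have "(r \<otimes> s) [^] (k + (k + 1)) = \<one>"
    using pow_ord_eq_1[OF rs] assms(3) by (simp add: coxeter_m_def mult_2)
  then have "(r \<otimes> s) [^] k \<otimes> (r \<otimes> s) [^] (k + 1) = \<one>"
    unfolding nat_pow_mult[OF rs] .
  then have "(r \<otimes> s) [^] k = inv ((r \<otimes> s) [^] (k + 1))"
    using rs by (metis inv_equality nat_pow_closed)
  also have "\<dots> = (s \<otimes> r) [^] (k + 1)" unfolding inv[symmetric] nat_pow_inv[OF rs] ..
  also have "\<dots> = s \<otimes> r \<otimes> (s \<otimes> r) [^] k" using nat_pow_Suc2[of "s \<otimes> r" k] c by (simp del: nat_pow_Suc)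
  also have "\<dots> = s \<otimes> ((r \<otimes> s) [^] k \<otimes> r)"
    using c by (simp add: m_assoc pow_shift)
  finally show ?thesis using c rs assms(1) by (simp add: m_assoc S_square)
qed

lemma mult_tail:
  "a \<otimes> b = c \<otimes> d \<Longrightarrow> a \<in> carrier W \<Longrightarrow> b \<in> carrier W \<Longrightarrow> c \<in> carrier W \<Longrightarrow> d \<in> carrier W \<Longrightarrow>
    z \<in> carrier W \<Longrightarrow> a \<otimes> (b \<otimes> z) = c \<otimes> (d \<otimes> z)"
  by (simp flip: m_assoc)

lemma square_tail:
  "t \<in> reflections W S \<Longrightarrow> z \<in> carrier W \<Longrightarrow> t \<otimes> (t \<otimes> z) = z"
  using reflection_square reflections_carrier by (simp flip: m_assoc)

text \<open>In all four products, moving each \<open>p\<close> and \<open>q\<close> to the right, by the exchange relations, until it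
meets another copy of itself leaves \<open>s1\<close>, \<open>s2\<close>, \<open>s3\<close>, \<open>s4\<close> only.\<close>

lemma bowtie_factorizations:
  assumes S: "s1 \<in> S" "s2 \<in> S" "s3 \<in> S" "s4 \<in> S"
    and pq: "p \<in> reflections W S" "q \<in> reflections W S"
    and comm: "s1 \<otimes> s3 = s3 \<otimes> s1" "s4 \<otimes> s2 = s2 \<otimes> s4"
    and swap: "p \<otimes> s1 = s2 \<otimes> p" "p \<otimes> s2 = s1 \<otimes> p" "q \<otimes> s3 = s4 \<otimes> q" "q \<otimes> s4 = s3 \<otimes> q"
    and g: "g1 = s4 \<otimes> ((s2 \<otimes> (p \<otimes> s2)) \<otimes> s4)" "g2 = s4 \<otimes> ((s2 \<otimes> (q \<otimes> s2)) \<otimes> s4)"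
  shows "word_prod W [p, p \<otimes> (s3 \<otimes> p), s4, g1] = word_prod W [s3, s1, s2, s4]"
    and "word_prod W [q, s4 \<otimes> (q \<otimes> s4), s4 \<otimes> (p \<otimes> s4), g1] = word_prod W [s3, s1, s2, s4]"
    and "word_prod W [p, s2 \<otimes> (p \<otimes> s2), s2 \<otimes> (q \<otimes> s2), g2] = word_prod W [s3, s1, s2, s4]"
    and "word_prod W [q, q \<otimes> (s1 \<otimes> q), s2, g2] = word_prod W [s3, s1, s2, s4]"
proof -
  have r: "s1 \<in> reflections W S" "s2 \<in> reflections W S" "s3 \<in> reflections W S" "s4 \<in> reflections W S"
    using S S_subset_reflections by auto
  note c = r[THEN reflections_carrier] pq[THEN reflections_carrier]
  \<comment> \<open>Oriented as rewrite rules on products nested to the right. The trailing \<open>\<one>\<close> of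
    \<open>word_prod\<close> ensures that each pair of letters has something behind it.\<close>
  note tails = comm[THEN mult_tail] swap[THEN mult_tail] r[THEN square_tail] pq[THEN square_tail]
  show "word_prod W [p, p \<otimes> (s3 \<otimes> p), s4, g1] = word_prod W [s3, s1, s2, s4]"
    and "word_prod W [q, s4 \<otimes> (q \<otimes> s4), s4 \<otimes> (p \<otimes> s4), g1] = word_prod W [s3, s1, s2, s4]"
    and "word_prod W [p, s2 \<otimes> (p \<otimes> s2), s2 \<otimes> (q \<otimes> s2), g2] = word_prod W [s3, s1, s2, s4]"
    and "word_prod W [q, q \<otimes> (s1 \<otimes> q), s2, g2] = word_prod W [s3, s1, s2, s4]"
    unfolding word_prod_Cons word_prod_Nil g
    using c by (simp_all only: m_assoc m_closed one_closed tails)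
qed

end

context coxeter_realization
begin

lemma rep_middle:
  assumes "r \<in> S" "s \<in> S" "coxeter_m W r s = 2 * k + 1" "k \<ge> 1"
  shows "rep ((r \<otimes> s) [^] k \<otimes> r) v
    = v - ((B (\<alpha> r) v + B (\<alpha> s) v) / (2 - 2 * cos (pi / (2 * k + 1)))) *\<^sub>R (\<alpha> r + \<alpha> s)"
proof -
  note c = S_carrier[OF assms(1)] S_carrier[OF assms(2)]
  have "rep ((r \<otimes> s) [^] k \<otimes> r) v = ((reflect (\<alpha> r) \<circ> reflect (\<alpha> s)) ^^ k) (reflect (\<alpha> r) v)"
  proof -
    have "rep (r \<otimes> s) = reflect (\<alpha> r) \<circ> reflect (\<alpha> s)"
      using c assms by (simp add: fun_eq_iff rep_mult rep_simple)
    then show ?thesis using c assms by (simp add: rep_mult rep_pow rep_simple)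
  qed
  also have "\<dots> = v - ((B (\<alpha> r) v + B (\<alpha> s) v) / (2 - 2 * cos (pi / (2 * k + 1)))) *\<^sub>R (\<alpha> r + \<alpha> s)"
  proof (rule middle_reflection)
    show "B (\<alpha> r) (\<alpha> r) = 2" "B (\<alpha> s) (\<alpha> s) = 2" using assms simple_norm by simp_all
    show "B (\<alpha> r) (\<alpha> s) = - 2 * cos (pi / (2 * k + 1))" using cartan assms by (simp add: add.commute)
    have "sin (pi / (2 * k + 1)) > 0"
      using assms(4) by (intro sin_gt_zero) (auto simp: field_simps)
    then show "sin (pi / (2 * k + 1)) \<noteq> 0" by simp
    show "real (2 * k + 1) * (pi / (2 * k + 1)) = pi" by simp
  qed
  finally show ?thesis .
qed

text \<open>The bowtie consists of \<open>p\<close> and \<open>q\<close> below \<open>c' g1\<close> and \<open>c' g2\<close>.\<close>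

lemma absolute_interval_not_lattice:
  assumes "finite S"
    and S: "s1 \<in> S" "s2 \<in> S" "s3 \<in> S" "s4 \<in> S" "distinct [s1, s2, s3, s4]"
    and k: "k \<ge> 1" "k' \<ge> 1" "l \<ge> 3"
    and m: "coxeter_m W s1 s2 = 2 * k + 1" "coxeter_m W s2 s3 = l"
      "coxeter_m W s3 s4 = 2 * k' + 1" "coxeter_m W s4 s1 = l"
      "coxeter_m W s1 s3 = 2" "coxeter_m W s2 s4 = 2"
    and c: "coxeter_element W S c" "restricts_to W S {s1, s2, s3, s4} c (word_prod W [s3, s1, s2, s4])"
  shows "\<not> lattice (absolute_interval W S c)"
proof -
  define p where "p = (s1 \<otimes> s2) [^] k \<otimes> s1"
  define q where "q = (s3 \<otimes> s4) [^] k' \<otimes> s3"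
  define g1 where "g1 = s4 \<otimes> ((s2 \<otimes> (p \<otimes> s2)) \<otimes> s4)"
  define g2 where "g2 = s4 \<otimes> ((s2 \<otimes> (q \<otimes> s2)) \<otimes> s4)"
  define c' where "c' = word_prod W [s3, s1, s2, s4]"
  define x where "x = 2 * cos (pi / l)"
  define y where "y = 2 * cos (pi / (2 * k + 1))"
  define z where "z = 2 * cos (pi / (2 * k' + 1))"
  have r: "s1 \<in> reflections W S" "s2 \<in> reflections W S" "s3 \<in> reflections W S" "s4 \<in> reflections W S"
    using S S_subset_reflections by auto
  have p: "p \<in> reflections W S" and q: "q \<in> reflections W S"
    unfolding p_def q_def using alternating_reflection S by auto
  note conj = reflections_conj_reflection
  have g: "g1 \<in> reflections W S" "g2 \<in> reflections W S"
    unfolding g1_def g2_def using p q r by (simp_all add: conj)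
  note car = r[THEN reflections_carrier] p[THEN reflections_carrier] q[THEN reflections_carrier]
    g[THEN reflections_carrier]
  have commute: "b \<otimes> a = a \<otimes> b" if "a \<in> S" "b \<in> S" "coxeter_m W a b = 2" for a b
  proof -
    have ab: "a \<in> carrier W" "b \<in> carrier W" using that S_carrier by auto
    then have "(a \<otimes> b) \<otimes> (a \<otimes> b) = \<one>"
      using that pow_ord_eq_1[of "a \<otimes> b"] by (simp add: coxeter_m_def numeral_2_eq_2)
    then have "inv (a \<otimes> b) = a \<otimes> b" using ab inv_equality by simp
    then show ?thesis using ab that inv_S by (simp add: inv_mult_group)
  qed
  have swap: "t \<otimes> b = a \<otimes> t" if "t \<in> reflections W S" "a \<in> carrier W" "b \<in> carrier W" "t \<otimes> a = b \<otimes> t" for t a b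
  proof -
    have "a \<otimes> t = (t \<otimes> (b \<otimes> t)) \<otimes> t" using square_tail[of t a] that by simp
    also have "\<dots> = t \<otimes> b"
      using that(1,3) reflections_carrier reflection_square by (simp add: m_assoc)
    finally show ?thesis ..
  qed
  have p1: "p \<otimes> s1 = s2 \<otimes> p" and q3: "q \<otimes> s3 = s4 \<otimes> q"
    unfolding p_def q_def using alternating_swap S m by auto
  note p2 = swap[OF p car(1,2) p1] and q4 = swap[OF q car(3,4) q3]
  have comm: "s1 \<otimes> s3 = s3 \<otimes> s1" "s4 \<otimes> s2 = s2 \<otimes> s4"
    using commute S m by auto
  note fact = bowtie_factorizations[OF S(1-4) p q comm p1 p2 q3 q4 g1_def g2_def, folded c'_def]
  obtain us where us: "reduced_expression W S c us"
    "word_prod W (filter (\<lambda>s. s \<in> {s1, s2, s3, s4}) us) = c'"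
    using c(2) unfolding restricts_to_def c'_def by blast
  obtain rs where rs: "rs \<in> lists (reflections W S)" "c = c' \<otimes> word_prod W rs"
    "reflection_length W S c = 4 + length rs"
  proof (rule reduced_subword_below[OF assms(1) c(1) us])
    show "{s1, s2, s3, s4} \<subseteq> S" using S by simp
    show thesis if "rs \<in> lists (reflections W S)" "c = c' \<otimes> word_prod W rs"
      "reflection_length W S c = card {s1, s2, s3, s4} + length rs"
      and "\<And>rs. rs \<in> lists (reflections W S) \<Longrightarrow> c = c' \<otimes> word_prod W rs \<Longrightarrow>
        reflection_length W S c = 4 + length rs \<Longrightarrow> thesis" for rs
      using that S(5) by simp
  qed
  have facs: "[p, p \<otimes> (s3 \<otimes> p), s4, g1] \<in> lists (reflections W S)"
    "[q, s4 \<otimes> (q \<otimes> s4), s4 \<otimes> (p \<otimes> s4), g1] \<in> lists (reflections W S)"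
    "[p, s2 \<otimes> (p \<otimes> s2), s2 \<otimes> (q \<otimes> s2), g2] \<in> lists (reflections W S)"
    "[q, q \<otimes> (s1 \<otimes> q), s2, g2] \<in> lists (reflections W S)"
    using p q r g by (simp_all add: conj)
  note below = prefixes_below[OF facs(1) rs(1) fact(1) rs(2,3)] prefixes_below[OF facs(2) rs(1) fact(2) rs(2,3)]
    prefixes_below[OF facs(3) rs(1) fact(3) rs(2,3)] prefixes_below[OF facs(4) rs(1) fact(4) rs(2,3)]
  have y2: "1 \<le> y" "y < 2" and z2: "1 \<le> z" "z < 2" and x1: "1 \<le> x"
    using two_cos_ge_1[of "2 * k + 1"] two_cos_ge_1[of "2 * k' + 1"] two_cos_ge_1[of l] k
    by (simp_all add: x_def y_def z_def add.commute)
  have rep_p: "rep p v = v - ((B (\<alpha> s1) v + B (\<alpha> s2) v) / (2 - y)) *\<^sub>R (\<alpha> s1 + \<alpha> s2)" for v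
    unfolding p_def y_def using rep_middle S m k by blast
  have rep_q: "rep q v = v - ((B (\<alpha> s3) v + B (\<alpha> s4) v) / (2 - z)) *\<^sub>R (\<alpha> s3 + \<alpha> s4)" for v
    unfolding q_def z_def using rep_middle S m k by blast
  have pq: "p \<noteq> q"
  proof
    assume "p = q"
    then have "rep p (\<omega> s1) = \<omega> s1" using rep_q[of "\<omega> s1"] S by (auto simp: dual)
    then have "\<alpha> s1 + \<alpha> s2 = 0" using y2 S by (auto simp: rep_p dual)
    then have "B (\<alpha> s1 + \<alpha> s2) (\<omega> s1) = 0" by (simp add: zero_left)
    then show False using S by (auto simp: add_left dual)
  qed
  have "g1 \<noteq> g2"
  proof
    assume "g1 = g2"
    then have "p = q" using car by (simp add: g1_def g2_def)
    then show False using pq by simp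
  qed
  then have yne: "c' \<otimes> g1 \<noteq> c' \<otimes> g2"
    using car S by (simp add: c'_def)
  have "(2 - y) * (2 - z) \<le> 1 * 1" using y2 z2 by (intro mult_mono) simp_all
  also have "\<dots> \<le> x\<^sup>2" using x1 by simp
  finally have bound: "(2 - y) * (2 - z) \<le> x\<^sup>2" .
  show ?thesis
  proof (rule not_lattice_if_bowtie[of p q c "c' \<otimes> g1" "c' \<otimes> g2"])
    fix n assume n: "n \<in> carrier W" "reflection_length W S n = 2" "absolute_le W S p n"
      "absolute_le W S q n" "absolute_le W S n (c' \<otimes> g1)"
    obtain t where t: "t \<in> reflections W S" "n = p \<otimes> t"
      using absolute_le_cover[of p n] n below car by auto
    obtain t' where t': "t' \<in> reflections W S" "n = q \<otimes> t'"
      using absolute_le_cover[of q n] n below car by auto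
    obtain u where u: "u \<in> reflections W S" "c' \<otimes> g1 = n \<otimes> u"
      using absolute_le_cover[of n "c' \<otimes> g1"] n below car by auto
    have "c' = word_prod W [p, t, u, g1]"
    proof -
      have "c' \<in> carrier W" using car S by (simp add: c'_def)
      then have "c' = (c' \<otimes> g1) \<otimes> g1" using car g reflection_square by (simp add: m_assoc)
      then show ?thesis
        unfolding u(2) t(2) using car t(1) u(1) reflections_carrier by (simp add: m_assoc)
    qed
    then show False
      using no_rank_two_factorization[OF S _ _ _ _ _ _ y2(2) z2(2) bound p q rep_p rep_q t(1) t'(1) u(1) g(1)]
        t(2) t'(2) S m cartan
      by (simp add: c'_def x_def y_def z_def add.commute)
  qed (use below car pq yne in auto)
qed

end

theorem corollary5p10:
  fixes W :: "('a, 'b) monoid_scheme" (structure)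
    and S S' :: "'a set"
    and s1 s2 s3 s4 c c' :: 'a
    and k k' l :: nat
  assumes "coxeter_system W S"
    and "finite S"
    and "S' = {s1, s2, s3, s4}"
    and "S' \<subseteq> S"
    and "distinct [s1, s2, s3, s4]"
    and "k \<ge> 1" "k' \<ge> 1" "l \<ge> 3"
    and "coxeter_m W s1 s2 = 2 * k + 1"
    and "coxeter_m W s2 s3 = l"
    and "coxeter_m W s3 s4 = 2 * k' + 1"
    and "coxeter_m W s4 s1 = l"
    and "coxeter_m W s1 s3 = 2"
    and "coxeter_m W s2 s4 = 2"
    and "coxeter_element W S c"
    and "restricts_to W S S' c c'"
    and "c' = s3 \<otimes> s1 \<otimes> s2 \<otimes> s4"
  shows "\<not> lattice (absolute_interval W S c)"
proof -
  interpret coxeter_system W S by fact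
  interpret coxeter_realization W S "matrix_form (S <+> S) (extended_cartan W)"
    "\<lambda>s. Poly_Mapping.single (Inl s) 1" "\<lambda>s. Poly_Mapping.single (Inr s) 1"
    using assms(2) by (rule coxeter_realization_exists)
  have S: "s1 \<in> S" "s2 \<in> S" "s3 \<in> S" "s4 \<in> S" using assms(3,4) by auto
  have "c' = word_prod W [s3, s1, s2, s4]"
    using S S_carrier assms(17) by (simp add: m_assoc)
  then have "restricts_to W S {s1, s2, s3, s4} c (word_prod W [s3, s1, s2, s4])"
    using assms(3,16) by simp
  then show ?thesis
    using absolute_interval_not_lattice[OF assms(2) S] assms by blast
qed

end
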